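(* Let $k$ be an algebraically closed field, let $n$ be an odd positive integer, and let $R=k\llbracket x,y\rrbracket/(y^2+x^n)$. Then for each $j\in\{1,2,\ldots,\frac{n-1}{2}\}$, $\tau_{(x^j,y)}(R)=(x^j,y)$, where $(x^j,y)$ in the subscript is the ideal of $R$ regarded as an $R$-module; and thus $\tau_{MCM}(R)=(x^{\frac{n-1}{2}},y)$.
   Context: All rings are commutative, unital, Noetherian and local. A maximal Cohen-Macaulay (MCM) module over a ring $R$ is a finitely generated (nonzero) $R$-module $M$ such that the length of the longest regular sequence on $M$ equals the Krull dimension of $R$; a sequence $x_1,\ldots,x_n$ in $R$ is regular on $M$ if $(x_1,\ldots,x_n)M\ne M$, $x_1$ is a non-zerodivisor on $M$, and $x_i$ is a non-zerodivisor on $M/(x_1,\ldots,x_{i-1})M$ for $2\le i\le n$. For an $R$-module $M$ and $R$-modules $A\subseteq B$, let $A_B^{\mathrm{cl}_M}=\{b\in B : x\otimes b\in \operatorname{im}(M\otimes_R A\to M\otimes_R B)\text{ for all }x\in M\}$. The test ideal of $R$ associated to $M$ is $\tau_M(R)=\bigcap_{A\subseteq B}(A:_R A_B^{\mathrm{cl}_M})$, the intersection over all pairs of $R$-modules $A\subseteq B$. By a known theorem, when $R$ is local and $M$ is finitely generated, $\tau_M(R)$ equals the trace ideal $\sum_{f\in\operatorname{Hom}_R(M,R)}f(M)$, and $\tau_M(R)$ denotes this common ideal. $\tau_{MCM}(R)=\bigcap_M \tau_M(R)$, the intersection over all isomorphism classes of maximal Cohen-Macaulay $R$-modules $M$. 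*)

theory Defs
  imports
    "HOL-Algebra.Algebra"
    "HOL-Algebra.Algebraic_Closure_Type"
    "HOL-Computational_Algebra.Computational_Algebra"
    "HOL-Library.Extended_Nat"
begin

section \<open>Modules\<close>

definition ideal_as_module :: "('r, 'a) ring_scheme \<Rightarrow> 'r set \<Rightarrow> ('r, 'r) module" where
  "ideal_as_module R I =
     \<lparr>carrier = I, monoid.mult = (\<otimes>\<^bsub>R\<^esub>), one = \<one>\<^bsub>R\<^esub>, ring.zero = \<zero>\<^bsub>R\<^esub>, add = (\<oplus>\<^bsub>R\<^esub>),
      module.smult = (\<otimes>\<^bsub>R\<^esub>)\<rparr>"

definition span_submodule ::
  "('r, 'a) ring_scheme \<Rightarrow> ('r, 'm, 'b) module_scheme \<Rightarrow> 'm set \<Rightarrow> 'm set" where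
  "span_submodule R M S = (\<lambda>N. submodule N R M) hull S"

definition fin_gen_module :: "('r, 'a) ring_scheme \<Rightarrow> ('r, 'm, 'b) module_scheme \<Rightarrow> bool" where
  "fin_gen_module R M \<longleftrightarrow>
     module R M \<and> (\<exists>S. finite S \<and> S \<subseteq> carrier M \<and> span_submodule R M S = carrier M)"

text \<open>The fields \<open>mult\<close> and \<open>one\<close>, which a module record inherits from \<open>ring\<close>, carry no
  meaning for a module and are left unspecified.\<close>

definition quotient_module :: "('r, 'm, 'b) module_scheme \<Rightarrow> 'm set \<Rightarrow> ('r, 'm set) module" where
  "quotient_module M N =
     \<lparr>carrier = a_rcosets\<^bsub>M\<^esub> N, monoid.mult = undefined, one = undefined, ring.zero = N,
      add = set_add M,
      module.smult = (\<lambda>r C. \<Union>m\<in>C. N +>\<^bsub>M\<^esub> (r \<odot>\<^bsub>M\<^esub> m))\<rparr>"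


section \<open>Maximal Cohen-Macaulay modules\<close>

definition krull_dim :: "('r, 'a) ring_scheme \<Rightarrow> enat" where
  "krull_dim R =
     Sup {enat d | d. \<exists>P :: nat \<Rightarrow> 'r set.
            (\<forall>i\<le>d. primeideal (P i) R) \<and> (\<forall>i<d. P i \<subset> P (Suc i))}"

text \<open>The submodule $(x_1,\ldots,x_n)M$, where \<open>S\<close> is the set of the $x_i$.\<close>

definition mult_submodule ::
  "('r, 'a) ring_scheme \<Rightarrow> ('r, 'm, 'b) module_scheme \<Rightarrow> 'r set \<Rightarrow> 'm set" where
  "mult_submodule R M S = span_submodule R M {x \<odot>\<^bsub>M\<^esub> m | x m. x \<in> S \<and> m \<in> carrier M}"

definition nonzerodivisor_on :: "('r, 'm, 'b) module_scheme \<Rightarrow> 'r \<Rightarrow> bool" where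
  "nonzerodivisor_on M x \<longleftrightarrow> (\<forall>m\<in>carrier M. x \<odot>\<^bsub>M\<^esub> m = \<zero>\<^bsub>M\<^esub> \<longrightarrow> m = \<zero>\<^bsub>M\<^esub>)"

text \<open>At index \<open>0\<close> the quotient below is $M/0$.\<close>

definition regular_sequence ::
  "('r, 'a) ring_scheme \<Rightarrow> ('r, 'm, 'b) module_scheme \<Rightarrow> 'r list \<Rightarrow> bool" where
  "regular_sequence R M xs \<longleftrightarrow>
     set xs \<subseteq> carrier R \<and>
     mult_submodule R M (set xs) \<noteq> carrier M \<and>
     (\<forall>i<length xs.
        nonzerodivisor_on (quotient_module M (mult_submodule R M (set (take i xs)))) (xs ! i))"

definition module_depth :: "('r, 'a) ring_scheme \<Rightarrow> ('r, 'm, 'b) module_scheme \<Rightarrow> enat" where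
  "module_depth R M = Sup {enat (length xs) | xs. regular_sequence R M xs}"

definition MCM_module :: "('r, 'a) ring_scheme \<Rightarrow> ('r, 'm, 'b) module_scheme \<Rightarrow> bool" where
  "MCM_module R M \<longleftrightarrow>
     fin_gen_module R M \<and> carrier M \<noteq> {\<zero>\<^bsub>M\<^esub>} \<and> module_depth R M = krull_dim R"


section \<open>Tensor products\<close>

text \<open>$M \otimes_R N$ is the free abelian group on $M \times N$ modulo the biadditivity and
  balancing relations. Only its abelian group structure is needed: the closure operation below
  asks for membership in the image of an induced map.\<close>

definition tensor_relators ::
  "('r, 'a) ring_scheme \<Rightarrow> ('r, 'm, 'b) module_scheme \<Rightarrow> ('r, 'n, 'c) module_scheme
     \<Rightarrow> ('m \<times> 'n \<Rightarrow>\<^sub>0 int) set" where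
  "tensor_relators R M N =
     {frag_of (m \<oplus>\<^bsub>M\<^esub> m', n) - frag_of (m, n) - frag_of (m', n) | m m' n.
        m \<in> carrier M \<and> m' \<in> carrier M \<and> n \<in> carrier N} \<union>
     {frag_of (m, n \<oplus>\<^bsub>N\<^esub> n') - frag_of (m, n) - frag_of (m, n') | m n n'.
        m \<in> carrier M \<and> n \<in> carrier N \<and> n' \<in> carrier N} \<union>
     {frag_of (r \<odot>\<^bsub>M\<^esub> m, n) - frag_of (m, r \<odot>\<^bsub>N\<^esub> n) | r m n.
        r \<in> carrier R \<and> m \<in> carrier M \<and> n \<in> carrier N}"

definition tensor_free ::
  "('r, 'm, 'b) module_scheme \<Rightarrow> ('r, 'n, 'c) module_scheme \<Rightarrow> ('m \<times> 'n \<Rightarrow>\<^sub>0 int) monoid" where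
  "tensor_free M N = free_Abelian_group (carrier M \<times> carrier N)"

definition tensor_kernel ::
  "('r, 'a) ring_scheme \<Rightarrow> ('r, 'm, 'b) module_scheme \<Rightarrow> ('r, 'n, 'c) module_scheme
     \<Rightarrow> ('m \<times> 'n \<Rightarrow>\<^sub>0 int) set" where
  "tensor_kernel R M N = generate (tensor_free M N) (tensor_relators R M N)"

definition tensor_product ::
  "('r, 'a) ring_scheme \<Rightarrow> ('r, 'm, 'b) module_scheme \<Rightarrow> ('r, 'n, 'c) module_scheme
     \<Rightarrow> ('m \<times> 'n \<Rightarrow>\<^sub>0 int) set monoid" where
  "tensor_product R M N = tensor_free M N Mod tensor_kernel R M N"

definition tensor_class ::
  "('r, 'a) ring_scheme \<Rightarrow> ('r, 'm, 'b) module_scheme \<Rightarrow> ('r, 'n, 'c) module_scheme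
     \<Rightarrow> ('m \<times> 'n \<Rightarrow>\<^sub>0 int) \<Rightarrow> ('m \<times> 'n \<Rightarrow>\<^sub>0 int) set" where
  "tensor_class R M N z = tensor_kernel R M N #>\<^bsub>tensor_free M N\<^esub> z"

definition pure_tensor ::
  "('r, 'a) ring_scheme \<Rightarrow> ('r, 'm, 'b) module_scheme \<Rightarrow> ('r, 'n, 'c) module_scheme
     \<Rightarrow> 'm \<Rightarrow> 'n \<Rightarrow> ('m \<times> 'n \<Rightarrow>\<^sub>0 int) set" where
  "pure_tensor R M N m n = tensor_class R M N (frag_of (m, n))"

text \<open>The map $\mathrm{id} \otimes f \colon M \otimes_R N \to M \otimes_R N'$ induced by an
  \<open>R\<close>-linear map $f \colon N \to N'$. The union over the representatives \<open>z\<close> of a coset is a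
  union of equal cosets.\<close>

definition tensor_map ::
  "('r, 'a) ring_scheme \<Rightarrow> ('r, 'm, 'b) module_scheme \<Rightarrow> ('r, 'n, 'c) module_scheme
     \<Rightarrow> ('n0 \<Rightarrow> 'n) \<Rightarrow> ('m \<times> 'n0 \<Rightarrow>\<^sub>0 int) set \<Rightarrow> ('m \<times> 'n \<Rightarrow>\<^sub>0 int) set" where
  "tensor_map R M N' f C =
     (\<Union>z\<in>C. tensor_class R M N' (frag_extend (\<lambda>(m, n). frag_of (m, f n)) z))"


section \<open>Test ideals\<close>

text \<open>The closure $A_B^{\mathrm{cl}_M}$; the submodule \<open>A\<close> of \<open>B\<close>, as a module in its own
  right, is \<open>B\<lparr>carrier := A\<rparr>\<close>.\<close>

definition module_closure ::
  "('r, 'a) ring_scheme \<Rightarrow> ('r, 'm, 'b) module_scheme \<Rightarrow> 'u set \<Rightarrow> ('r, 'u, 'c) module_scheme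
     \<Rightarrow> 'u set" where
  "module_closure R M A B =
     {b \<in> carrier B. \<forall>x\<in>carrier M.
        pure_tensor R M B x b
          \<in> tensor_map R M B (\<lambda>a. a) ` carrier (tensor_product R M (B\<lparr>carrier := A\<rparr>))}"

definition module_colon ::
  "('r, 'a) ring_scheme \<Rightarrow> ('r, 'u, 'c) module_scheme \<Rightarrow> 'u set \<Rightarrow> 'u set \<Rightarrow> 'r set" where
  "module_colon R B A C = {r \<in> carrier R. \<forall>c\<in>C. r \<odot>\<^bsub>B\<^esub> c \<in> A}"

text \<open>A type cannot be quantified inside a definition, so the elements of the modules \<open>B\<close> (and,
  for \<open>tau_MCM\<close>, of the MCM modules) are taken from a universe type \<open>'u\<close>, which is a
  parameter.\<close>

definition test_ideal ::
  "'u itself \<Rightarrow> ('r, 'a) ring_scheme \<Rightarrow> ('r, 'm, 'b) module_scheme \<Rightarrow> 'r set" where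
  "test_ideal U R M =
     {r \<in> carrier R. \<forall>(B :: ('r, 'u) module) A.
        module R B \<longrightarrow> submodule A R B \<longrightarrow> r \<in> module_colon R B A (module_closure R M A B)}"

definition tau_MCM :: "'u itself \<Rightarrow> ('r, 'a) ring_scheme \<Rightarrow> 'r set" where
  "tau_MCM U R =
     {r \<in> carrier R. \<forall>M :: ('r, 'u) module. MCM_module R M \<longrightarrow> r \<in> test_ideal U R M}"


section \<open>The ring $k[[x,y]]/(y^2+x^n)$\<close>

text \<open>$k[[x,y]]$ is realised as $(k[[x]])[[y]]$, that is, as the type \<open>'k fps fps\<close>: the
  outer variable is \<open>y\<close>, and \<open>x\<close> is the inner one.\<close>

definition ps_ring :: "'k::field fps fps ring" where
  "ps_ring = ring_of_type_algebra"

definition ps_x :: "'k::field fps fps" where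
  "ps_x = fps_const fps_X"

definition ps_y :: "'k::field fps fps" where
  "ps_y = fps_X"

definition curve_ideal :: "nat \<Rightarrow> 'k::field fps fps set" where
  "curve_ideal n = Idl\<^bsub>ps_ring\<^esub> {ps_y ^ 2 + ps_x ^ n}"

definition curve_ring :: "nat \<Rightarrow> 'k::field fps fps set ring" where
  "curve_ring n = ps_ring Quot curve_ideal n"

definition curve_x :: "nat \<Rightarrow> 'k::field fps fps set" where
  "curve_x n = curve_ideal n +>\<^bsub>ps_ring\<^esub> ps_x"

definition curve_y :: "nat \<Rightarrow> 'k::field fps fps set" where
  "curve_y n = curve_ideal n +>\<^bsub>ps_ring\<^esub> ps_y"

end

theory Submission
  imports Defs
begin

text \<open>Every element of $R = k[[x,y]]/(y^2 + x^n)$ is uniquely $a + b y$ with $a, b \in k[[x]]$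
  (Weierstrass division, \<open>curve_coords_curve_ring\<close>), so \<open>R\<close> is the free $k[[x]]$-module on
  $1, y$ with $y^2 = -x^n$. Put $I_j = (x^j, y)$ and $m = (n-1)/2$.

  Two bounds on the test ideal of a module carry the proof. From below, it contains all values of
  functionals $f \colon M \to R$, because $f \otimes \mathrm{id}$ takes $x \otimes b$ to $f(x) b$
  (\<open>trace_in_test_ideal\<close>). From above, if $bM \subseteq aM$, then \<open>b\<close> lies in the closure
  of $aR$ in \<open>R\<close>, and so $\tau_M(R) \subseteq (aR : b)$ (\<open>test_ideal_times_subset\<close>).

  For $M = I_j$ with $2j \le n$ the two bounds agree. The inclusion $I_j \subseteq R$ is a functional with
  image $I_j$. On the other side $y I_j \subseteq x^j I_j$, since $y^2 = -x^n$, and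
  $(x^j R : y) = I_j$ by inspection of coordinates.

  As $I_m$ is itself MCM, $\tau_{MCM}(R) \subseteq I_m$. For the reverse inclusion, an MCM module
  over the one-dimensional domain \<open>R\<close> is torsion-free (\<open>MCM_module_torsion_free\<close>) and
  therefore has a nonzero functional \<open>f\<close> (\<open>exists_nonzero_functional\<close>). Put
  $t = y/x^m$, so that $k[[t]]$ is the normalization of \<open>R\<close>. Dividing \<open>f\<close> by a value of
  least order in \<open>t\<close> gives a map into $k[[t]]$ that takes the value \<open>1\<close>,
  and $I_m$ is the conductor of \<open>R\<close> in $k[[t]]$; so multiplying by an element of $I_m$ leads back
  to \<open>R\<close> and yields a functional with that element as a value (\<open>conductor_functional\<close>). The
  normalization enters only through its valuation, which is the order of the norm
  $a^2 + x^n b^2$.\<close>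

section \<open>Tensor relations and the closure operation\<close>

lemma carrier_tensor_free [simp]:
  "z \<in> carrier (tensor_free M N) \<longleftrightarrow> Poly_Mapping.keys z \<subseteq> carrier M \<times> carrier N"
  by (simp add: tensor_free_def)

lemma tensor_relators_in_free:
  assumes "module R M" "module R N"
  shows "tensor_relators R M N \<subseteq> carrier (tensor_free M N)"
proof -
  interpret M: module R M by fact
  interpret N: module R N by fact
  have k2: "Poly_Mapping.keys (frag_of p - frag_of q) \<subseteq> {p, q}" for p q :: "'c \<times> 'e"
    using keys_diff[of "frag_of p" "frag_of q"] by (auto simp: keys_frag_of)
  have k3: "Poly_Mapping.keys (frag_of p - frag_of q - frag_of r) \<subseteq> {p, q, r}" for p q r :: "'c \<times> 'e"
    using keys_diff[of "frag_of p - frag_of q" "frag_of r"] k2[of p q] by (auto simp: keys_frag_of)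
  show ?thesis
    unfolding tensor_relators_def by (auto dest!: subsetD[OF k2] subsetD[OF k3])
qed

lemma subgroup_tensor_kernel:
  assumes "module R M" "module R N"
  shows "subgroup (tensor_kernel R M N) (tensor_free M N)"
  unfolding tensor_kernel_def
  using tensor_relators_in_free[OF assms]
  by (intro group.generate_is_subgroup) (simp_all add: tensor_free_def)

lemma tensor_kernel_closed:
  assumes "module R M" "module R N"
  shows "0 \<in> tensor_kernel R M N"
    and "u \<in> tensor_kernel R M N \<Longrightarrow> v \<in> tensor_kernel R M N \<Longrightarrow> u + v \<in> tensor_kernel R M N"
    and "u \<in> tensor_kernel R M N \<Longrightarrow> v \<in> tensor_kernel R M N \<Longrightarrow> u - v \<in> tensor_kernel R M N"
proof -
  note sg = subgroup_tensor_kernel[OF assms]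
  show "0 \<in> tensor_kernel R M N"
    using subgroup.one_closed[OF sg] by (simp add: tensor_free_def)
  show add: "u + v \<in> tensor_kernel R M N"
    if "u \<in> tensor_kernel R M N" "v \<in> tensor_kernel R M N" for u v
    using subgroup.m_closed[OF sg that] by (simp add: tensor_free_def)
  have "- v \<in> tensor_kernel R M N" if "v \<in> tensor_kernel R M N" for v
    using subgroup.m_inv_closed[OF sg that] subgroup.mem_carrier[OF sg that]
    by (simp add: tensor_free_def)
  then show "u - v \<in> tensor_kernel R M N"
    if "u \<in> tensor_kernel R M N" "v \<in> tensor_kernel R M N" for u v
    using add that by force
qed

lemma tensor_relator_in_kernel:
  "u \<in> tensor_relators R M N \<Longrightarrow> u \<in> tensor_kernel R M N"
  unfolding tensor_kernel_def by (rule generate.incl)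

text \<open>Tensors are handled through representatives in the free group: two of them are equal in
  the tensor product when their difference lies in the kernel.\<close>

lemma tensor_class_altdef: "tensor_class R M N z = (\<lambda>h. h + z) ` tensor_kernel R M N"
  by (auto simp: tensor_class_def tensor_free_def r_coset_def)

lemma tensor_class_eqI:
  assumes "module R M" "module R N" "u - v \<in> tensor_kernel R M N"
  shows "tensor_class R M N u = tensor_class R M N v"
proof -
  note cl = tensor_kernel_closed[OF assms(1,2)]
  have "h + u = (h + (u - v)) + v" "h + v = (h - (u - v)) + u" for h
    by simp_all
  then show ?thesis
    unfolding tensor_class_altdef using cl(2,3) assms(3) by blast
qed

lemma tensor_kernel_submodule_subset:
  assumes "module R M" "module R B" "submodule A R B"
  shows "tensor_kernel R M (B\<lparr>carrier := A\<rparr>) \<subseteq> tensor_kernel R M B"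
proof
  interpret B: module R B by fact
  have A: "A \<subseteq> carrier B" using B.submoduleE(1)[OF assms(3)] .
  have mA: "module R (B\<lparr>carrier := A\<rparr>)"
    using submodule.submodule_is_module[OF assms(3,2)] .
  have rel: "tensor_relators R M (B\<lparr>carrier := A\<rparr>) \<subseteq> tensor_relators R M B"
  proof -
    have eqs: "carrier (B\<lparr>carrier := A\<rparr>) = A" "add (B\<lparr>carrier := A\<rparr>) = add B"
      "module.smult (B\<lparr>carrier := A\<rparr>) = module.smult B" by simp_all
    show ?thesis
      unfolding tensor_relators_def eqs
      by (intro Un_mono Collect_mono impI)
        (elim exE conjE, intro exI conjI, (assumption | erule subsetD[OF A])+)+
  qed
  fix z assume "z \<in> tensor_kernel R M (B\<lparr>carrier := A\<rparr>)"
  then have "z \<in> generate (tensor_free M (B\<lparr>carrier := A\<rparr>)) (tensor_relators R M (B\<lparr>carrier := A\<rparr>))"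
    by (simp add: tensor_kernel_def)
  then show "z \<in> tensor_kernel R M B"
  proof induction
    case one
    show ?case using tensor_kernel_closed(1)[OF assms(1,2)] by (simp add: tensor_free_def)
  next
    case (incl h)
    then show ?case using rel tensor_relator_in_kernel by blast
  next
    case (inv h)
    have "h \<in> carrier (tensor_free M (B\<lparr>carrier := A\<rparr>))"
      using inv tensor_relators_in_free[OF assms(1) mA] by blast
    then have "inv\<^bsub>tensor_free M (B\<lparr>carrier := A\<rparr>)\<^esub> h = 0 - h"
      by (simp add: tensor_free_def)
    then show ?case
      using tensor_kernel_closed(3)[OF assms(1,2) tensor_kernel_closed(1)[OF assms(1,2)]]
        tensor_relator_in_kernel[OF subsetD[OF rel inv]] by simp
  next
    case (eng h1 h2)
    then show ?case using tensor_kernel_closed(2)[OF assms(1,2)] by (simp add: tensor_free_def)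
  qed
qed

text \<open>For an inclusion $A \subseteq B$ the induced map acts on representatives as the identity, so
  that $M \otimes A \to M \otimes B$ only enlarges the group of relations.\<close>

lemma tensor_map_inclusion:
  fixes C :: "('c \<times> 'd \<Rightarrow>\<^sub>0 int) set"
  shows
  "tensor_map R M B (\<lambda>a. a) C = (\<Union>z\<in>C. tensor_class R M B z)"
proof -
  have "(\<lambda>(m, n). frag_of (m, n)) = (frag_of :: 'c \<times> 'd \<Rightarrow> _)" by auto
  then show ?thesis by (simp add: tensor_map_def flip: frag_expansion)
qed

text \<open>Together with its converse below, this replaces the closure by a condition in the free group:
  $x \otimes b$ has a representative supported on $M \times A$.\<close>

lemma module_closureD:
  assumes "module R M" "module R B" "submodule A R B"
    and "b \<in> module_closure R M A B" "x \<in> carrier M"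
  obtains z where "Poly_Mapping.keys z \<subseteq> carrier M \<times> A"
    and "z - frag_of (x, b) \<in> tensor_kernel R M B"
proof -
  let ?A = "B\<lparr>carrier := A\<rparr>"
  have mA: "module R ?A"
    using submodule.submodule_is_module[OF assms(3,2)] .
  obtain C where C: "C \<in> carrier (tensor_product R M ?A)"
    and eq: "pure_tensor R M B x b = tensor_map R M B (\<lambda>a. a) C"
    using assms(4,5) unfolding module_closure_def by blast
  obtain z where z: "z \<in> carrier (tensor_free M ?A)"
    and Cz: "C = tensor_kernel R M ?A #>\<^bsub>tensor_free M ?A\<^esub> z"
    using C by (auto simp: tensor_product_def FactGroup_def RCOSETS_def)
  have "z \<in> C"
    using tensor_kernel_closed(1)[OF assms(1) mA] unfolding Cz
    by (force simp: tensor_free_def r_coset_def)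
  moreover have "z \<in> tensor_class R M B z"
    using tensor_kernel_closed(1)[OF assms(1,2)] by (force simp: tensor_class_altdef)
  ultimately have "z \<in> pure_tensor R M B x b"
    by (auto simp: eq tensor_map_inclusion)
  then have "z - frag_of (x, b) \<in> tensor_kernel R M B"
    by (auto simp: pure_tensor_def tensor_class_altdef)
  then show thesis using z by (intro that[of z]) auto
qed

lemma module_closureI:
  assumes "module R M" "module R B" "submodule A R B" "b \<in> carrier B"
    and "\<And>x. x \<in> carrier M \<Longrightarrow> \<exists>z. Poly_Mapping.keys z \<subseteq> carrier M \<times> A \<and>
            z - frag_of (x, b) \<in> tensor_kernel R M B"
  shows "b \<in> module_closure R M A B"
proof -
  let ?A = "B\<lparr>carrier := A\<rparr>"
  have mA: "module R ?A"
    using submodule.submodule_is_module[OF assms(3,2)] .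
  have "pure_tensor R M B x b
      \<in> tensor_map R M B (\<lambda>a. a) ` carrier (tensor_product R M ?A)" if x: "x \<in> carrier M" for x
  proof -
    obtain z where z: "Poly_Mapping.keys z \<subseteq> carrier M \<times> A"
      and k: "z - frag_of (x, b) \<in> tensor_kernel R M B"
      using assms(5)[OF x] by blast
    define C where "C = tensor_class R M ?A z"
    have "tensor_class R M B z' = pure_tensor R M B x b" if z': "z' \<in> C" for z'
      unfolding pure_tensor_def
    proof (rule tensor_class_eqI[OF assms(1,2)])
      obtain h where h: "h \<in> tensor_kernel R M ?A" "z' = h + z"
        using z' unfolding C_def tensor_class_altdef by blast
      have "h + (z - frag_of (x, b)) \<in> tensor_kernel R M B"
        using h(1) tensor_kernel_submodule_subset[OF assms(1-3)] k
        by (intro tensor_kernel_closed(2)[OF assms(1,2)]) auto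
      then show "z' - frag_of (x, b) \<in> tensor_kernel R M B"
        by (simp add: h(2) algebra_simps)
    qed
    moreover have "z \<in> C"
      using tensor_kernel_closed(1)[OF assms(1) mA] by (force simp: C_def tensor_class_altdef)
    ultimately have "pure_tensor R M B x b = tensor_map R M B (\<lambda>a. a) C"
      by (auto simp: tensor_map_inclusion)
    moreover have "C \<in> carrier (tensor_product R M ?A)"
      using z by (auto simp: C_def tensor_class_def tensor_product_def FactGroup_def RCOSETS_def)
    ultimately show ?thesis by blast
  qed
  then show ?thesis using assms(4) by (simp add: module_closure_def)
qed


section \<open>The trace bounds the test ideal from below\<close>

definition linear_functional :: "('r, 'a) ring_scheme \<Rightarrow> ('r, 'm, 'b) module_scheme \<Rightarrow> ('m \<Rightarrow> 'r) \<Rightarrow> bool" where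
  "linear_functional R M f \<longleftrightarrow>
     f \<in> carrier M \<rightarrow> carrier R \<and>
     (\<forall>m\<in>carrier M. \<forall>m'\<in>carrier M. f (m \<oplus>\<^bsub>M\<^esub> m') = f m \<oplus>\<^bsub>R\<^esub> f m') \<and>
     (\<forall>r\<in>carrier R. \<forall>m\<in>carrier M. f (r \<odot>\<^bsub>M\<^esub> m) = r \<otimes>\<^bsub>R\<^esub> f m)"

text \<open>If $x \otimes b$ comes from $M \otimes A$, then $f \otimes \mathrm{id}$ carries it to
  $f(x) b$ and carries $M \otimes A$ into \<open>A\<close>. So $f(x)$ multiplies the closure of \<open>A\<close>
  into \<open>A\<close>, for every pair $A \subseteq B$: the trace of \<open>M\<close> lies in its test ideal.\<close>

lemma trace_in_test_ideal:
  assumes M: "module R M" and f: "linear_functional R M f" and x: "x \<in> carrier M"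
  shows "f x \<in> test_ideal U R M"
proof -
  interpret M: module R M by fact
  have fc: "f m \<in> carrier R" if "m \<in> carrier M" for m
    using f that by (auto simp: linear_functional_def)
  have "f x \<odot>\<^bsub>B\<^esub> b \<in> A" if B: "module R B" and A: "submodule A R B"
    and b: "b \<in> module_closure R M A B" for B :: "('a, 'u) module" and A b
  proof -
    interpret B: module R B by fact
    have AB: "A \<subseteq> carrier B" using B.submoduleE(1)[OF A] .
    have bB: "b \<in> carrier B" using b by (simp add: module_closure_def)
    have cg: "comm_group (add_monoid B)" by (rule B.a_comm_group)
    have sgA: "subgroup A (add_monoid B)" using submodule.axioms(1)[OF A] .
    \<comment> \<open>The map $f \otimes \mathrm{id} \colon M \otimes B \to B$, on the free group.\<close>
    let ?\<phi> = "\<lambda>(m, c). f m \<odot>\<^bsub>B\<^esub> c"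
    have "?\<phi> ` (carrier M \<times> carrier B) \<subseteq> carrier (add_monoid B)"
      using fc by auto
    then obtain h where h: "h \<in> hom (tensor_free M B) (add_monoid B)"
      and h_of: "\<And>p. p \<in> carrier M \<times> carrier B \<Longrightarrow> h (frag_of p) = ?\<phi> p"
      using comm_group.free_Abelian_group_universal[OF cg, of ?\<phi> "carrier M \<times> carrier B"]
      unfolding tensor_free_def by blast
    have grp: "group (tensor_free M B)" by (simp add: tensor_free_def)
    interpret h: group_hom "tensor_free M B" "add_monoid B" h
      using h grp cg by (simp add: group_hom_def group_hom_axioms_def comm_group_def)
    define F :: "('c \<times> 'u \<Rightarrow>\<^sub>0 int) set" where "F = {u. Poly_Mapping.keys u \<subseteq> carrier M \<times> carrier B}"
    have F_diff: "u - v \<in> F" if "u \<in> F" "v \<in> F" for u v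
      using that keys_diff[of u v] by (auto simp: F_def)
    have F_of: "frag_of (m, c) \<in> F" if "m \<in> carrier M" "c \<in> carrier B" for m c
      using that by (simp add: F_def)
    have h_closed: "h u \<in> carrier B" if "u \<in> F" for u
      using h.hom_closed[of u] that by (simp add: F_def)
    have h_diff: "h (u - v) = h u \<ominus>\<^bsub>B\<^esub> h v" if u: "u \<in> F" and v: "v \<in> F" for u v
    proof -
      have "h (u \<otimes>\<^bsub>tensor_free M B\<^esub> inv\<^bsub>tensor_free M B\<^esub> v) = h u \<oplus>\<^bsub>B\<^esub> inv\<^bsub>add_monoid B\<^esub> h v"
        using h.hom_mult[of u "inv\<^bsub>tensor_free M B\<^esub> v"] h.hom_inv[of v]
          group.inv_closed[OF grp, of v] u v
        by (simp add: F_def)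
      then show ?thesis
        using u v by (simp add: F_def tensor_free_def a_minus_def a_inv_def)
    qed
    have "tensor_relators R M B \<subseteq> kernel (tensor_free M B) (add_monoid B) h"
    proof
      fix u assume u: "u \<in> tensor_relators R M B"
      have cancel: "p \<oplus>\<^bsub>B\<^esub> q \<ominus>\<^bsub>B\<^esub> p \<ominus>\<^bsub>B\<^esub> q = \<zero>\<^bsub>B\<^esub>" if "p \<in> carrier B" "q \<in> carrier B" for p q
        using that by (simp add: a_minus_def B.M.a_comm[of p q] B.M.a_assoc B.M.r_neg)
      have cancel': "p \<ominus>\<^bsub>B\<^esub> p = \<zero>\<^bsub>B\<^esub>" if "p \<in> carrier B" for p
        using that by (simp add: a_minus_def B.M.r_neg)
      have f_add: "f (m \<oplus>\<^bsub>M\<^esub> m') = f m \<oplus>\<^bsub>R\<^esub> f m'" if "m \<in> carrier M" "m' \<in> carrier M" for m m'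
        using f that by (simp add: linear_functional_def)
      have f_smult: "f (r \<odot>\<^bsub>M\<^esub> m) \<odot>\<^bsub>B\<^esub> c = f m \<odot>\<^bsub>B\<^esub> (r \<odot>\<^bsub>B\<^esub> c)"
        if "r \<in> carrier R" "m \<in> carrier M" "c \<in> carrier B" for r m c
        using f that fc by (simp add: linear_functional_def M.R.m_comm flip: B.smult_assoc1)
      have "h u = \<zero>\<^bsub>B\<^esub>"
        using u unfolding tensor_relators_def
        by (auto simp: h_diff F_diff F_of h_of fc f_add f_smult B.smult_l_distr B.smult_r_distr
            cancel cancel')
      then show "u \<in> kernel (tensor_free M B) (add_monoid B) h"
        using subsetD[OF tensor_relators_in_free[OF M B] u] by (simp add: kernel_def)
    qed
    then have "tensor_kernel R M B \<subseteq> kernel (tensor_free M B) (add_monoid B) h"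
      unfolding tensor_kernel_def
      by (intro group.generate_subgroup_incl[OF grp] h.subgroup_kernel)
    then have h_ker: "h u = \<zero>\<^bsub>B\<^esub>" if "u \<in> tensor_kernel R M B" for u
      using that by (auto simp: kernel_def)
    have h_A: "u \<in> F \<and> h u \<in> A" if "Poly_Mapping.keys u \<subseteq> carrier M \<times> A" for u
      using that
    proof (induction rule: frag_induction)
      case zero
      show ?case using h.hom_one subgroup.one_closed[OF sgA]
        by (simp add: F_def tensor_free_def)
    next
      case (one p)
      then show ?case
        using AB fc submodule.smult_closed[OF A] by (auto simp: F_def h_of keys_frag_of)
    next
      case (diff u v)
      then show ?case
        using B.submoduleE(3,5)[OF A] by (auto simp: h_diff F_diff a_minus_def)
    qed
    obtain z where z: "Poly_Mapping.keys z \<subseteq> carrier M \<times> A"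
      and k: "z - frag_of (x, b) \<in> tensor_kernel R M B"
      using module_closureD[OF M B A b x] .
    have "h z \<ominus>\<^bsub>B\<^esub> f x \<odot>\<^bsub>B\<^esub> b = \<zero>\<^bsub>B\<^esub>"
      using h_ker[OF k] h_A[OF z] x bB by (simp add: h_diff F_of h_of)
    then have "h z = f x \<odot>\<^bsub>B\<^esub> b"
      using h_A[OF z] h_closed fc[OF x] bB
      by (metis B.M.add.inv_closed B.M.minus_equality B.M.minus_minus B.smult_closed a_minus_def)
    then show ?thesis using h_A[OF z] by simp
  qed
  then show ?thesis
    using fc[OF x] by (auto simp: test_ideal_def module_colon_def)
qed

section \<open>Colon ideals bound the test ideal from above\<close>

lemma ideal_as_module_simps [simp]:
  "carrier (ideal_as_module R I) = I"
  "\<zero>\<^bsub>ideal_as_module R I\<^esub> = \<zero>\<^bsub>R\<^esub>"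
  "add (ideal_as_module R I) = add R"
  "module.smult (ideal_as_module R I) = monoid.mult R"
  by (simp_all add: ideal_as_module_def)

lemma module_ideal_as_module:
  assumes "cring R" "ideal I R"
  shows "module R (ideal_as_module R I)"
proof -
  interpret R: cring R by fact
  interpret I: ideal I R by fact
  note c = I.a_Hcarr
  show ?thesis
  proof (rule moduleI)
    show "abelian_group (ideal_as_module R I)"
    proof (rule abelian_groupI)
      fix u assume "u \<in> carrier (ideal_as_module R I)"
      then show "\<exists>v\<in>carrier (ideal_as_module R I). v \<oplus>\<^bsub>ideal_as_module R I\<^esub> u = \<zero>\<^bsub>ideal_as_module R I\<^esub>"
        by (intro bexI[of _ "\<ominus>\<^bsub>R\<^esub> u"]) (auto simp: c R.l_neg)
    qed (auto simp: c R.a_assoc intro: R.a_comm)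
  qed (auto simp: c R.l_distr R.r_distr R.m_assoc I.I_l_closed assms)
qed

text \<open>Test ideals range over modules on a fixed universe type, so a module whose elements live
  elsewhere has to be transported along an injection \<open>\<kappa>\<close> before it can serve as a witness.\<close>

definition module_copy :: "('m \<Rightarrow> 'u) \<Rightarrow> ('r, 'm, 'b) module_scheme \<Rightarrow> ('r, 'u) module" where
  "module_copy \<kappa> M =
     (let unc = inv_into (carrier M) \<kappa> in
      \<lparr>carrier = \<kappa> ` carrier M, monoid.mult = undefined, one = undefined,
       ring.zero = \<kappa> \<zero>\<^bsub>M\<^esub>, add = (\<lambda>u v. \<kappa> (unc u \<oplus>\<^bsub>M\<^esub> unc v)),
       module.smult = (\<lambda>r u. \<kappa> (r \<odot>\<^bsub>M\<^esub> unc u))\<rparr>)"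

lemma module_copy_simps [simp]:
  "carrier (module_copy \<kappa> M) = \<kappa> ` carrier M"
  "\<zero>\<^bsub>module_copy \<kappa> M\<^esub> = \<kappa> \<zero>\<^bsub>M\<^esub>"
  by (simp_all add: module_copy_def Let_def)

lemma module_copy_ops:
  assumes "inj_on \<kappa> (carrier M)"
  shows "m \<in> carrier M \<Longrightarrow> m' \<in> carrier M \<Longrightarrow> \<kappa> m \<oplus>\<^bsub>module_copy \<kappa> M\<^esub> \<kappa> m' = \<kappa> (m \<oplus>\<^bsub>M\<^esub> m')"
    and "m \<in> carrier M \<Longrightarrow> r \<odot>\<^bsub>module_copy \<kappa> M\<^esub> \<kappa> m = \<kappa> (r \<odot>\<^bsub>M\<^esub> m)"
  using assms by (simp_all add: module_copy_def Let_def)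

lemma module_module_copy:
  assumes "module R M" "inj_on \<kappa> (carrier M)"
  shows "module R (module_copy \<kappa> M)"
proof -
  interpret M: module R M by fact
  note ops = module_copy_ops[OF assms(2)]
  show ?thesis
  proof (rule moduleI)
    show "abelian_group (module_copy \<kappa> M)"
    proof (rule abelian_groupI)
      fix u assume "u \<in> carrier (module_copy \<kappa> M)"
      then obtain m where m: "m \<in> carrier M" "u = \<kappa> m" by auto
      then show "\<exists>v\<in>carrier (module_copy \<kappa> M). v \<oplus>\<^bsub>module_copy \<kappa> M\<^esub> u = \<zero>\<^bsub>module_copy \<kappa> M\<^esub>"
        by (intro bexI[of _ "\<kappa> (\<ominus>\<^bsub>M\<^esub> m)"]) (auto simp: ops M.M.l_neg)
    qed (auto simp: ops M.M.a_assoc intro: arg_cong[OF M.M.a_comm])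
  qed (auto simp: ops M.smult_l_distr M.smult_r_distr M.smult_assoc1 M.R.is_cring)
qed

text \<open>The bound from above, $\tau_M(R) \subseteq (aR : b)$ whenever $bM \subseteq aM$. The pair that
  shows it is $aR \subseteq R$: writing $b m = a m'$ gives
  $m \otimes b = b m \otimes 1 = a m' \otimes 1 = m' \otimes a$, so \<open>b\<close> is in the closure of
  $aR$, and an element of the test ideal multiplies it into $aR$.\<close>

lemma test_ideal_times_subset:
  fixes \<kappa> :: "'r \<Rightarrow> 'u"
  assumes M: "module R M" and \<kappa>: "inj_on \<kappa> (carrier R)"
    and a: "a \<in> carrier R" and b: "b \<in> carrier R"
    and ba: "\<And>m. m \<in> carrier M \<Longrightarrow> \<exists>m'\<in>carrier M. b \<odot>\<^bsub>M\<^esub> m = a \<odot>\<^bsub>M\<^esub> m'"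
    and r: "r \<in> test_ideal TYPE('u) R M"
  shows "\<exists>s\<in>carrier R. r \<otimes>\<^bsub>R\<^esub> b = a \<otimes>\<^bsub>R\<^esub> s"
proof -
  interpret M: module R M by fact
  define R0 where "R0 = ideal_as_module R (carrier R)"
  define B where "B = module_copy \<kappa> R0"
  define A where "A = \<kappa> ` {a \<otimes>\<^bsub>R\<^esub> s | s. s \<in> carrier R}"
  have \<kappa>0: "inj_on \<kappa> (carrier R0)" using \<kappa> by (simp add: R0_def)
  have R0: "module R R0"
    unfolding R0_def by (rule module_ideal_as_module[OF M.R.is_cring M.R.oneideal])
  have B: "module R B" unfolding B_def by (rule module_module_copy[OF R0 \<kappa>0])
  interpret B: module R B by fact
  have add: "\<kappa> p \<oplus>\<^bsub>B\<^esub> \<kappa> q = \<kappa> (p \<oplus>\<^bsub>R\<^esub> q)"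
    and smult: "p \<odot>\<^bsub>B\<^esub> \<kappa> q = \<kappa> (p \<otimes>\<^bsub>R\<^esub> q)" if "p \<in> carrier R" "q \<in> carrier R" for p q
    using module_copy_ops[OF \<kappa>0, of p q] module_copy_ops(2)[OF \<kappa>0, of q p] that
    by (simp_all add: B_def R0_def)
  have carr: "carrier B = \<kappa> ` carrier R" and zero: "\<zero>\<^bsub>B\<^esub> = \<kappa> \<zero>\<^bsub>R\<^esub>"
    by (simp_all add: B_def R0_def)
  have A: "submodule A R B"
  proof (rule B.submoduleI)
    show "\<zero>\<^bsub>B\<^esub> \<in> A" using a by (force simp: A_def zero intro!: exI[of _ "\<zero>\<^bsub>R\<^esub>"])
    show smA: "p \<odot>\<^bsub>B\<^esub> u \<in> A" if "p \<in> carrier R" "u \<in> A" for p u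
      using that a by (force simp: A_def smult M.R.m_lcomm)
    show "\<ominus>\<^bsub>B\<^esub> u \<in> A" if u: "u \<in> A" for u
    proof -
      have "u \<in> carrier B" using u a by (auto simp: A_def carr)
      then have "\<ominus>\<^bsub>B\<^esub> u = (\<ominus>\<^bsub>R\<^esub> \<one>\<^bsub>R\<^esub>) \<odot>\<^bsub>B\<^esub> u" by (simp add: B.smult_l_minus)
      then show ?thesis using smA[OF _ u] by simp
    qed
    show "u \<oplus>\<^bsub>B\<^esub> v \<in> A" if uv: "u \<in> A" "v \<in> A" for u v
    proof -
      obtain s t where "s \<in> carrier R" "t \<in> carrier R" "u = \<kappa> (a \<otimes>\<^bsub>R\<^esub> s)" "v = \<kappa> (a \<otimes>\<^bsub>R\<^esub> t)"
        using uv by (auto simp: A_def)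
      then show ?thesis
        unfolding A_def using a by (intro image_eqI[of _ _ "a \<otimes>\<^bsub>R\<^esub> (s \<oplus>\<^bsub>R\<^esub> t)"])
          (auto simp: add M.R.r_distr intro!: exI[of _ "s \<oplus>\<^bsub>R\<^esub> t"])
    qed
  qed (use a in \<open>auto simp: A_def carr\<close>)
  have "\<kappa> b \<in> module_closure R M A B"
  proof (rule module_closureI[OF M B A])
    fix x assume x: "x \<in> carrier M"
    then obtain x' where x': "x' \<in> carrier M" "b \<odot>\<^bsub>M\<^esub> x = a \<odot>\<^bsub>M\<^esub> x'" using ba by blast
    \<comment> \<open>The two balancing relations $b x \otimes 1 = x \otimes b$ and $a x' \otimes 1 = x' \otimes a$.\<close>
    let ?rel = "\<lambda>s m. frag_of (s \<odot>\<^bsub>M\<^esub> m, \<kappa> \<one>\<^bsub>R\<^esub>) - frag_of (m, s \<odot>\<^bsub>B\<^esub> \<kappa> \<one>\<^bsub>R\<^esub>)"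
    have "?rel s m \<in> tensor_kernel R M B" if "s \<in> carrier R" "m \<in> carrier M" for s m
    proof (rule tensor_relator_in_kernel)
      have "\<kappa> \<one>\<^bsub>R\<^esub> \<in> carrier B" by (simp add: carr)
      then show "?rel s m \<in> tensor_relators R M B"
        using that unfolding tensor_relators_def by blast
    qed
    then have "?rel b x - ?rel a x' \<in> tensor_kernel R M B"
      using tensor_kernel_closed(3)[OF M B] a b x x'(1) by blast
    then have "frag_of (x', \<kappa> a) - frag_of (x, \<kappa> b) \<in> tensor_kernel R M B"
      using a b by (simp add: smult x'(2))
    moreover have "\<kappa> a \<in> A"
      unfolding A_def using a
      by (intro image_eqI[of _ _ "a \<otimes>\<^bsub>R\<^esub> \<one>\<^bsub>R\<^esub>"]) (simp, blast)
    ultimately show "\<exists>z. Poly_Mapping.keys z \<subseteq> carrier M \<times> A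
        \<and> z - frag_of (x, \<kappa> b) \<in> tensor_kernel R M B"
      using x'(1) by (intro exI[of _ "frag_of (x', \<kappa> a)"]) simp
  qed (use b in \<open>simp add: carr\<close>)
  then have "r \<odot>\<^bsub>B\<^esub> \<kappa> b \<in> A" and rR: "r \<in> carrier R"
    using r B A unfolding test_ideal_def module_colon_def by blast+
  then have "\<kappa> (r \<otimes>\<^bsub>R\<^esub> b) \<in> A" using b by (simp add: smult)
  then obtain s where "s \<in> carrier R" "\<kappa> (r \<otimes>\<^bsub>R\<^esub> b) = \<kappa> (a \<otimes>\<^bsub>R\<^esub> s)"
    by (auto simp: A_def)
  then show ?thesis using \<kappa> a b rR by (metis M.R.m_closed inj_onD)
qed

section \<open>Functionals on torsion-free modules\<close>

definition torsion_free :: "('r, 'a) ring_scheme \<Rightarrow> ('r, 'm, 'b) module_scheme \<Rightarrow> bool" where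
  "torsion_free R M \<longleftrightarrow>
     (\<forall>r\<in>carrier R. \<forall>m\<in>carrier M. r \<odot>\<^bsub>M\<^esub> m = \<zero>\<^bsub>M\<^esub> \<longrightarrow> r = \<zero>\<^bsub>R\<^esub> \<or> m = \<zero>\<^bsub>M\<^esub>)"

context module
begin

lemma span_submodule_superset: "S \<subseteq> span_submodule R M S"
  unfolding span_submodule_def by (rule hull_subset)

lemma span_submodule_minimal: "submodule N R M \<Longrightarrow> S \<subseteq> N \<Longrightarrow> span_submodule R M S \<subseteq> N"
  unfolding span_submodule_def by (rule hull_minimal)

lemma submodule_span_submodule:
  assumes "S \<subseteq> carrier M"
  shows "submodule (span_submodule R M S) R M"
proof (rule submoduleI)
  show "span_submodule R M S \<subseteq> carrier M"
    using assms carrier_is_submodule by (rule span_submodule_minimal[rotated])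
  have span: "u \<in> span_submodule R M S \<longleftrightarrow> (\<forall>N. submodule N R M \<and> S \<subseteq> N \<longrightarrow> u \<in> N)" for u
    by (auto simp: span_submodule_def hull_def)
  show "\<zero>\<^bsub>M\<^esub> \<in> span_submodule R M S"
    using submodule.axioms(1) subgroup.one_closed unfolding span by fastforce
qed (auto simp: span_submodule_def hull_def dest: submoduleE(3,4,5))

lemma submodule_zero: "submodule {\<zero>\<^bsub>M\<^esub>} R M"
  by (rule submoduleI) auto

lemma span_submodule_empty: "span_submodule R M {} = {\<zero>\<^bsub>M\<^esub>}"
proof -
  have "submodule (span_submodule R M {}) R M" by (rule submodule_span_submodule) simp
  then have "\<zero>\<^bsub>M\<^esub> \<in> span_submodule R M {}"
    using submodule.axioms(1) subgroup.one_closed by fastforce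
  then show ?thesis using span_submodule_minimal[OF submodule_zero] by blast
qed

lemma span_submodule_insertE:
  assumes s: "s \<in> carrier M" and S: "S \<subseteq> carrier M"
    and n: "n \<in> span_submodule R M (insert s S)"
  obtains r h where "r \<in> carrier R" "h \<in> span_submodule R M S" "n = r \<odot>\<^bsub>M\<^esub> s \<oplus>\<^bsub>M\<^esub> h"
proof -
  define H where "H = span_submodule R M S"
  define N where "N = {r \<odot>\<^bsub>M\<^esub> s \<oplus>\<^bsub>M\<^esub> h | r h. r \<in> carrier R \<and> h \<in> H}"
  have H: "submodule H R M" unfolding H_def by (rule submodule_span_submodule[OF S])
  have HM: "h \<in> carrier M" if "h \<in> H" for h using submoduleE(1)[OF H] that by blast
  have zero: "\<zero>\<^bsub>M\<^esub> \<in> H" using submodule.axioms(1)[OF H] subgroup.one_closed by fastforce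
  have "submodule N R M"
  proof (rule submoduleI)
    show "N \<subseteq> carrier M" using s HM by (auto simp: N_def)
    show "\<zero>\<^bsub>M\<^esub> \<in> N"
      using zero s by (auto simp: N_def intro!: exI[of _ "\<zero>\<^bsub>R\<^esub>"] exI[of _ "\<zero>\<^bsub>M\<^esub>"])
  next
    fix u assume "u \<in> N"
    then obtain r h where u: "r \<in> carrier R" "h \<in> H" "u = r \<odot>\<^bsub>M\<^esub> s \<oplus>\<^bsub>M\<^esub> h" by (auto simp: N_def)
    then have "\<ominus>\<^bsub>M\<^esub> u = (\<ominus>\<^bsub>R\<^esub> r) \<odot>\<^bsub>M\<^esub> s \<oplus>\<^bsub>M\<^esub> \<ominus>\<^bsub>M\<^esub> h"
      using s HM by (simp add: smult_l_minus M.minus_add)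
    then show "\<ominus>\<^bsub>M\<^esub> u \<in> N" using u submoduleE(3)[OF H] unfolding N_def by blast
  next
    fix u v assume "u \<in> N" "v \<in> N"
    then obtain r h r' h' where u: "r \<in> carrier R" "h \<in> H" "u = r \<odot>\<^bsub>M\<^esub> s \<oplus>\<^bsub>M\<^esub> h"
      and v: "r' \<in> carrier R" "h' \<in> H" "v = r' \<odot>\<^bsub>M\<^esub> s \<oplus>\<^bsub>M\<^esub> h'" by (auto simp: N_def)
    then have "u \<oplus>\<^bsub>M\<^esub> v = (r \<oplus>\<^bsub>R\<^esub> r') \<odot>\<^bsub>M\<^esub> s \<oplus>\<^bsub>M\<^esub> (h \<oplus>\<^bsub>M\<^esub> h')"
      using s HM by (simp add: smult_l_distr M.a_ac)
    then show "u \<oplus>\<^bsub>M\<^esub> v \<in> N" using u v submoduleE(5)[OF H] unfolding N_def by blast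
  next
    fix a u assume a: "a \<in> carrier R" and "u \<in> N"
    then obtain r h where u: "r \<in> carrier R" "h \<in> H" "u = r \<odot>\<^bsub>M\<^esub> s \<oplus>\<^bsub>M\<^esub> h" by (auto simp: N_def)
    then have "a \<odot>\<^bsub>M\<^esub> u = (a \<otimes>\<^bsub>R\<^esub> r) \<odot>\<^bsub>M\<^esub> s \<oplus>\<^bsub>M\<^esub> a \<odot>\<^bsub>M\<^esub> h"
      using s a HM by (simp add: smult_r_distr smult_assoc1)
    then show "a \<odot>\<^bsub>M\<^esub> u \<in> N" using a u submoduleE(4)[OF H] unfolding N_def by blast
  qed
  moreover have "insert s S \<subseteq> N"
  proof -
    have "s \<in> N" using zero s by (auto simp: N_def intro!: exI[of _ "\<one>\<^bsub>R\<^esub>"] exI[of _ "\<zero>\<^bsub>M\<^esub>"])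
    moreover have "h \<in> N" if "h \<in> H" for h
      using that s HM by (auto simp: N_def intro!: exI[of _ "\<zero>\<^bsub>R\<^esub>"] exI[of _ h])
    ultimately show ?thesis using span_submodule_superset by (auto simp: H_def)
  qed
  ultimately have "n \<in> N" using n span_submodule_minimal by blast
  then show thesis using that by (auto simp: N_def H_def)
qed

end

text \<open>A finitely generated torsion-free module over a domain embeds in a free module; one nonzero
  coordinate function is enough here, and induction on the generators produces it. Let \<open>H\<close> be
  the span of all generators but \<open>s\<close>. If no nonzero multiple of \<open>s\<close> lies in \<open>H\<close>, the
  coefficient of \<open>s\<close> is a functional. Otherwise some $a \neq 0$ sends the whole span into
  \<open>H\<close>, and a functional on \<open>H\<close> composed with multiplication by \<open>a\<close> is still nonzero.\<close>

lemma exists_nonzero_functional_on_span: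
  assumes R: "domain R" and M: "module R M" and tf: "torsion_free R M"
    and "finite S" "S \<subseteq> carrier M" "span_submodule R M S \<noteq> {\<zero>\<^bsub>M\<^esub>}"
  shows "\<exists>f. linear_functional R (M\<lparr>carrier := span_submodule R M S\<rparr>) f \<and>
           (\<exists>m\<in>span_submodule R M S. f m \<noteq> \<zero>\<^bsub>R\<^esub>)"
  using assms(4-6)
proof (induction S)
  case empty
  then show ?case using module.span_submodule_empty[OF M] by simp
next
  case (insert s S)
  interpret R: domain R by fact
  interpret M: module R M by fact
  define H where "H = span_submodule R M S"
  define N where "N = span_submodule R M (insert s S)"
  have s: "s \<in> carrier M" and S: "S \<subseteq> carrier M" using insert.prems by auto
  have H: "submodule H R M" unfolding H_def by (rule M.submodule_span_submodule[OF S])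
  have N: "submodule N R M" unfolding N_def by (rule M.submodule_span_submodule) (use s S in auto)
  have HM: "h \<in> carrier M" if "h \<in> H" for h using M.submoduleE(1)[OF H] that by blast
  have NM: "h \<in> carrier M" if "h \<in> N" for h using M.submoduleE(1)[OF N] that by blast
  have HN: "H \<subseteq> N" unfolding H_def
    using M.span_submodule_superset[of "insert s S"] N
    by (intro M.span_submodule_minimal) (auto simp: N_def)
  have sN: "s \<in> N" using M.span_submodule_superset[of "insert s S"] by (auto simp: N_def)
  have NE: "\<exists>r h. r \<in> carrier R \<and> h \<in> H \<and> n = r \<odot>\<^bsub>M\<^esub> s \<oplus>\<^bsub>M\<^esub> h" if "n \<in> N" for n
    using M.span_submodule_insertE[OF s S] that unfolding N_def H_def by metis
  show ?case
  proof (cases "\<forall>a\<in>carrier R. a \<odot>\<^bsub>M\<^esub> s \<in> H \<longrightarrow> a = \<zero>\<^bsub>R\<^esub>")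
    case True
    define P where "P n r \<longleftrightarrow> r \<in> carrier R \<and> (\<exists>h\<in>H. n = r \<odot>\<^bsub>M\<^esub> s \<oplus>\<^bsub>M\<^esub> h)" for n r
    have uniq: "r = r'" if P: "P n r" "P n r'" for n r r'
    proof -
      obtain h h' where r: "r \<in> carrier R" "r' \<in> carrier R" and h: "h \<in> H" "h' \<in> H"
        and eq: "r \<odot>\<^bsub>M\<^esub> s \<oplus>\<^bsub>M\<^esub> h = r' \<odot>\<^bsub>M\<^esub> s \<oplus>\<^bsub>M\<^esub> h'"
        using P by (auto simp: P_def)
      have "(r \<ominus>\<^bsub>R\<^esub> r') \<odot>\<^bsub>M\<^esub> s = r \<odot>\<^bsub>M\<^esub> s \<oplus>\<^bsub>M\<^esub> h \<ominus>\<^bsub>M\<^esub> h \<ominus>\<^bsub>M\<^esub> r' \<odot>\<^bsub>M\<^esub> s"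
        using s r HM[OF h(1)] by (simp add: a_minus_def M.smult_l_distr M.smult_l_minus M.M.a_assoc M.M.r_neg)
      also have "\<dots> = h' \<ominus>\<^bsub>M\<^esub> h"
        unfolding eq using s r HM[OF h(1)] HM[OF h(2)]
        by (simp add: a_minus_def M.M.a_comm[of "r' \<odot>\<^bsub>M\<^esub> s" h'] M.M.a_assoc
            M.M.a_comm[of "\<ominus>\<^bsub>M\<^esub> h" "\<ominus>\<^bsub>M\<^esub> (r' \<odot>\<^bsub>M\<^esub> s)"] M.M.r_neg1 M.M.r_neg2)
      also have "\<dots> \<in> H" using M.submoduleE(3,5)[OF H] h by (simp add: a_minus_def)
      finally have "r \<ominus>\<^bsub>R\<^esub> r' = \<zero>\<^bsub>R\<^esub>" using True r by simp
      then show ?thesis using r by simp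
    qed
    have ex: "\<exists>r. P n r" if "n \<in> N" for n using NE[OF that] by (auto simp: P_def)
    define \<phi> where "\<phi> n = (THE r. P n r)" for n
    have \<phi>: "P n (\<phi> n)" if "n \<in> N" for n
      unfolding \<phi>_def using ex[OF that] uniq by (metis theI)
    have \<phi>_eq: "\<phi> n = r" if "P n r" "n \<in> N" for n r using uniq \<phi> that by blast
    have "linear_functional R (M\<lparr>carrier := N\<rparr>) \<phi>"
      unfolding linear_functional_def
    proof (simp, intro conjI ballI funcsetI)
      show "\<phi> n \<in> carrier R" if "n \<in> N" for n using \<phi>[OF that] by (simp add: P_def)
      fix n n' assume n: "n \<in> N" "n' \<in> N"
      obtain h h' where h: "h \<in> H" "h' \<in> H" "n = \<phi> n \<odot>\<^bsub>M\<^esub> s \<oplus>\<^bsub>M\<^esub> h" "n' = \<phi> n' \<odot>\<^bsub>M\<^esub> s \<oplus>\<^bsub>M\<^esub> h'"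
        "\<phi> n \<in> carrier R" "\<phi> n' \<in> carrier R"
        using \<phi>[OF n(1)] \<phi>[OF n(2)] by (auto simp: P_def)
      have "n \<oplus>\<^bsub>M\<^esub> n' = (\<phi> n \<oplus>\<^bsub>R\<^esub> \<phi> n') \<odot>\<^bsub>M\<^esub> s \<oplus>\<^bsub>M\<^esub> (h \<oplus>\<^bsub>M\<^esub> h')"
        by (subst h(3), subst h(4)) (use s HM h(1,2,5,6) in \<open>simp add: M.smult_l_distr M.M.a_ac\<close>)
      then show "\<phi> (n \<oplus>\<^bsub>M\<^esub> n') = \<phi> n \<oplus>\<^bsub>R\<^esub> \<phi> n'"
        using M.submoduleE(5)[OF H h(1,2)] h(5,6) M.submoduleE(5)[OF N n]
        by (intro \<phi>_eq) (auto simp: P_def)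
    next
      fix r n assume r: "r \<in> carrier R" and n: "n \<in> N"
      obtain h where h: "h \<in> H" "n = \<phi> n \<odot>\<^bsub>M\<^esub> s \<oplus>\<^bsub>M\<^esub> h" "\<phi> n \<in> carrier R"
        using \<phi>[OF n] by (auto simp: P_def)
      have "r \<odot>\<^bsub>M\<^esub> n = (r \<otimes>\<^bsub>R\<^esub> \<phi> n) \<odot>\<^bsub>M\<^esub> s \<oplus>\<^bsub>M\<^esub> r \<odot>\<^bsub>M\<^esub> h"
        by (subst h(2)) (use s HM h(1,3) r in \<open>simp add: M.smult_r_distr M.smult_assoc1\<close>)
      then show "\<phi> (r \<odot>\<^bsub>M\<^esub> n) = r \<otimes>\<^bsub>R\<^esub> \<phi> n"
        using M.submoduleE(4)[OF H r h(1)] h(3) r M.submoduleE(4)[OF N r n]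
        by (intro \<phi>_eq) (auto simp: P_def)
    qed
    moreover have "P s \<one>\<^bsub>R\<^esub>"
      unfolding P_def using s subgroup.one_closed[OF submodule.axioms(1)[OF H]]
      by (auto intro!: bexI[of _ "\<zero>\<^bsub>M\<^esub>"])
    then have "\<phi> s \<noteq> \<zero>\<^bsub>R\<^esub>" using \<phi>_eq sN by simp
    ultimately show ?thesis using sN unfolding N_def by blast
  next
    case False
    then obtain a where a: "a \<in> carrier R" "a \<odot>\<^bsub>M\<^esub> s \<in> H" "a \<noteq> \<zero>\<^bsub>R\<^esub>" by blast
    have aN: "a \<odot>\<^bsub>M\<^esub> n \<in> H" if nN: "n \<in> N" for n
    proof -
      obtain r h where r: "r \<in> carrier R" and h: "h \<in> H" and n: "n = r \<odot>\<^bsub>M\<^esub> s \<oplus>\<^bsub>M\<^esub> h"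
        using NE[OF nN] by blast
      have "a \<odot>\<^bsub>M\<^esub> n = r \<odot>\<^bsub>M\<^esub> (a \<odot>\<^bsub>M\<^esub> s) \<oplus>\<^bsub>M\<^esub> a \<odot>\<^bsub>M\<^esub> h"
        using r a(1) s HM[OF h] R.m_comm[of a r]
        by (simp add: n M.smult_r_distr flip: M.smult_assoc1)
      then show ?thesis using M.submoduleE(4,5)[OF H] r a h by simp
    qed
    have anz: "a \<odot>\<^bsub>M\<^esub> n \<noteq> \<zero>\<^bsub>M\<^esub>" if "n \<in> N" "n \<noteq> \<zero>\<^bsub>M\<^esub>" for n
      using tf a NM that unfolding torsion_free_def by blast
    have "\<zero>\<^bsub>M\<^esub> \<in> N" using subgroup.one_closed[OF submodule.axioms(1)[OF N]] by simp
    then obtain n where "n \<in> N" "n \<noteq> \<zero>\<^bsub>M\<^esub>" using insert.prems(2) unfolding N_def by blast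
    then have "H \<noteq> {\<zero>\<^bsub>M\<^esub>}" using aN anz by blast
    then obtain f h where f: "linear_functional R (M\<lparr>carrier := H\<rparr>) f" and h: "h \<in> H" "f h \<noteq> \<zero>\<^bsub>R\<^esub>"
      using insert.IH S unfolding H_def by blast
    have "linear_functional R (M\<lparr>carrier := N\<rparr>) (\<lambda>n. f (a \<odot>\<^bsub>M\<^esub> n))"
      using f a(1) aN NM unfolding linear_functional_def
      by (auto simp: M.smult_r_distr M.smult_assoc1[symmetric] R.m_comm[OF a(1)])
        (auto simp: M.smult_assoc1)
    moreover have "f (a \<odot>\<^bsub>M\<^esub> h) = a \<otimes>\<^bsub>R\<^esub> f h" "f h \<in> carrier R"
      using f a(1) h by (auto simp: linear_functional_def)
    then have "f (a \<odot>\<^bsub>M\<^esub> h) \<noteq> \<zero>\<^bsub>R\<^esub>" using a h R.integral by auto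
    ultimately show ?thesis using HN h unfolding N_def by blast
  qed
qed

lemma exists_nonzero_functional:
  assumes "domain R" "fin_gen_module R M" "torsion_free R M" "carrier M \<noteq> {\<zero>\<^bsub>M\<^esub>}"
  obtains f m where "linear_functional R M f" "m \<in> carrier M" "f m \<noteq> \<zero>\<^bsub>R\<^esub>"
proof -
  obtain S where "module R M" "finite S" "S \<subseteq> carrier M" "span_submodule R M S = carrier M"
    using assms(2) by (auto simp: fin_gen_module_def)
  then show thesis
    using exists_nonzero_functional_on_span[OF assms(1) _ assms(3), of S] assms(4) that by auto
qed

section \<open>Maximal Cohen-Macaulay modules over one-dimensional local domains\<close>

text \<open>Regularity on $M/N$, phrased with elements of \<open>M\<close> so that cosets disappear.\<close>

lemma nonzerodivisor_on_quotient_module_iff: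
  assumes M: "module R M" and N: "submodule N R M" and z: "z \<in> carrier R"
  shows "nonzerodivisor_on (quotient_module M N) z \<longleftrightarrow>
    (\<forall>m\<in>carrier M. z \<odot>\<^bsub>M\<^esub> m \<in> N \<longrightarrow> m \<in> N)"
proof -
  interpret M: module R M by fact
  have sg: "subgroup N (add_monoid M)" using submodule.axioms(1)[OF N] .
  interpret N: abelian_subgroup N M
    using sg M.abelian_group_axioms by (intro abelian_subgroupI3 additive_subgroup.intro)
  have coset_eq: "N +>\<^bsub>M\<^esub> m = N \<longleftrightarrow> m \<in> N" if "m \<in> carrier M" for m
    using N.a_rcos_self[OF that] N.a_rcos_const[of m] by auto
  have smult: "module.smult (quotient_module M N) z (N +>\<^bsub>M\<^esub> m) = N \<longleftrightarrow> z \<odot>\<^bsub>M\<^esub> m \<in> N"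
    if m: "m \<in> carrier M" for m
  proof -
    have rep: "N +>\<^bsub>M\<^esub> z \<odot>\<^bsub>M\<^esub> m' = N +>\<^bsub>M\<^esub> z \<odot>\<^bsub>M\<^esub> m" if m': "m' \<in> N +>\<^bsub>M\<^esub> m" for m'
    proof -
      obtain h where h: "h \<in> N" "m' = h \<oplus>\<^bsub>M\<^esub> m"
        using m' by (auto simp: a_r_coset_def r_coset_def)
      have "z \<odot>\<^bsub>M\<^esub> m' = z \<odot>\<^bsub>M\<^esub> h \<oplus>\<^bsub>M\<^esub> z \<odot>\<^bsub>M\<^esub> m" using h m z by (simp add: M.smult_r_distr)
      then have "z \<odot>\<^bsub>M\<^esub> m' \<in> N +>\<^bsub>M\<^esub> z \<odot>\<^bsub>M\<^esub> m"
        using M.submoduleE(4)[OF N z h(1)] by (auto simp: a_r_coset_def r_coset_def)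
      then show ?thesis
        using N.a_repr_independence'[of "z \<odot>\<^bsub>M\<^esub> m'" "z \<odot>\<^bsub>M\<^esub> m"] m z by simp
    qed
    have "module.smult (quotient_module M N) z (N +>\<^bsub>M\<^esub> m) =
        (\<Union>m'\<in>N +>\<^bsub>M\<^esub> m. N +>\<^bsub>M\<^esub> z \<odot>\<^bsub>M\<^esub> m')"
      by (simp add: quotient_module_def)
    also have "\<dots> = (\<Union>m'\<in>N +>\<^bsub>M\<^esub> m. N +>\<^bsub>M\<^esub> z \<odot>\<^bsub>M\<^esub> m)"
      by (rule SUP_cong[OF refl rep])
    also have "\<dots> = N +>\<^bsub>M\<^esub> z \<odot>\<^bsub>M\<^esub> m"
      using N.a_rcos_self[OF m] by (intro cSUP_const) blast
    finally have "module.smult (quotient_module M N) z (N +>\<^bsub>M\<^esub> m) = N +>\<^bsub>M\<^esub> z \<odot>\<^bsub>M\<^esub> m" .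
    then show ?thesis using coset_eq m z by simp
  qed
  have "carrier (quotient_module M N) = (\<lambda>m. N +>\<^bsub>M\<^esub> m) ` carrier M" "\<zero>\<^bsub>quotient_module M N\<^esub> = N"
    by (auto simp: quotient_module_def A_RCOSETS_def RCOSETS_def a_r_coset_def)
  then have "nonzerodivisor_on (quotient_module M N) z \<longleftrightarrow>
      (\<forall>m\<in>carrier M. module.smult (quotient_module M N) z (N +>\<^bsub>M\<^esub> m) = N \<longrightarrow> N +>\<^bsub>M\<^esub> m = N)"
    unfolding nonzerodivisor_on_def by simp
  then show ?thesis by (simp add: smult coset_eq)
qed

lemma (in module) submodule_mult_submodule:
  "S \<subseteq> carrier R \<Longrightarrow> submodule (mult_submodule R M S) R M"
  unfolding mult_submodule_def by (rule submodule_span_submodule) auto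

lemma (in module) smult_in_mult_submodule:
  "z \<in> S \<Longrightarrow> m \<in> carrier M \<Longrightarrow> z \<odot>\<^bsub>M\<^esub> m \<in> mult_submodule R M S"
  unfolding mult_submodule_def
  by (rule subsetD[OF span_submodule_superset], intro CollectI exI conjI) (rule refl)

lemma (in module) mult_submodule_empty: "mult_submodule R M {} = {\<zero>\<^bsub>M\<^esub>}"
  by (simp add: mult_submodule_def span_submodule_empty)

lemma (in module) mult_submodule_mono: "S \<subseteq> T \<Longrightarrow> mult_submodule R M S \<subseteq> mult_submodule R M T"
  unfolding mult_submodule_def span_submodule_def by (rule hull_mono) blast

lemma (in module) mult_submodule_singleton:
  assumes p: "p \<in> carrier R"
  shows "mult_submodule R M {p} = {p \<odot>\<^bsub>M\<^esub> m | m. m \<in> carrier M}" (is "_ = ?N")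
proof
  show "?N \<subseteq> mult_submodule R M {p}" using smult_in_mult_submodule[of p "{p}"] by auto
  have "submodule ?N R M"
  proof (rule submoduleI)
    show "\<zero>\<^bsub>M\<^esub> \<in> ?N" by (intro CollectI exI[of _ "\<zero>\<^bsub>M\<^esub>"]) (use p in simp)
    show "\<ominus>\<^bsub>M\<^esub> u \<in> ?N" if "u \<in> ?N" for u
    proof -
      obtain m where "m \<in> carrier M" "u = p \<odot>\<^bsub>M\<^esub> m" using \<open>u \<in> ?N\<close> by blast
      then have "\<ominus>\<^bsub>M\<^esub> u = p \<odot>\<^bsub>M\<^esub> (\<ominus>\<^bsub>M\<^esub> m)" "\<ominus>\<^bsub>M\<^esub> m \<in> carrier M"
        using p by (simp_all add: smult_r_minus)
      then show ?thesis by (intro CollectI exI conjI)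
    qed
    show "u \<oplus>\<^bsub>M\<^esub> v \<in> ?N" if "u \<in> ?N" "v \<in> ?N" for u v
    proof -
      obtain m m' where "m \<in> carrier M" "u = p \<odot>\<^bsub>M\<^esub> m" "m' \<in> carrier M" "v = p \<odot>\<^bsub>M\<^esub> m'"
        using \<open>u \<in> ?N\<close> \<open>v \<in> ?N\<close> by blast
      then have "u \<oplus>\<^bsub>M\<^esub> v = p \<odot>\<^bsub>M\<^esub> (m \<oplus>\<^bsub>M\<^esub> m')" "m \<oplus>\<^bsub>M\<^esub> m' \<in> carrier M"
        using p by (simp_all add: smult_r_distr)
      then show ?thesis by (intro CollectI exI conjI)
    qed
    show "a \<odot>\<^bsub>M\<^esub> u \<in> ?N" if a: "a \<in> carrier R" and "u \<in> ?N" for a u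
    proof -
      obtain m where m: "m \<in> carrier M" "u = p \<odot>\<^bsub>M\<^esub> m" using \<open>u \<in> ?N\<close> by blast
      then have "a \<odot>\<^bsub>M\<^esub> u = p \<odot>\<^bsub>M\<^esub> (a \<odot>\<^bsub>M\<^esub> m)" "a \<odot>\<^bsub>M\<^esub> m \<in> carrier M"
        using a p m smult_assoc1[of a p m] smult_assoc1[of p a m] R.m_comm[of a p] by simp_all
      then show ?thesis by (intro CollectI exI conjI)
    qed
  qed (use p in auto)
  then show "mult_submodule R M {p} \<subseteq> ?N"
    unfolding mult_submodule_def by (rule span_submodule_minimal) auto
qed

lemma (in module) regular_sequence_nonunit:
  assumes "regular_sequence R M xs" "z \<in> set xs"
  shows "z \<notin> Units R"
proof
  assume z: "z \<in> Units R"
  have "carrier M \<subseteq> mult_submodule R M (set xs)"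
  proof
    fix m assume m: "m \<in> carrier M"
    have "z \<odot>\<^bsub>M\<^esub> (inv\<^bsub>R\<^esub> z \<odot>\<^bsub>M\<^esub> m) = m"
      using z m smult_assoc1[of z "inv\<^bsub>R\<^esub> z" m] by (simp add: R.Units_closed)
    then show "m \<in> mult_submodule R M (set xs)"
      using smult_in_mult_submodule[OF assms(2), of "inv\<^bsub>R\<^esub> z \<odot>\<^bsub>M\<^esub> m"] z m by simp
  qed
  moreover have "mult_submodule R M (set xs) \<subseteq> carrier M"
    using assms(1) by (intro submoduleE(1)[OF submodule_mult_submodule]) (simp add: regular_sequence_def)
  ultimately show False using assms(1) by (simp add: regular_sequence_def)
qed

text \<open>Locality is expressed by the nonunits being closed under addition. That every nonunit is
  nilpotent modulo every nonzero element means dimension at most one; this condition controls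
  the Krull dimension and the depth of modules alike. A nonzero nonunit excludes fields.\<close>

locale one_dim_local_domain = domain R for R (structure) +
  assumes nonunits_add:
      "\<lbrakk>a \<in> carrier R; b \<in> carrier R; a \<notin> Units R; b \<notin> Units R\<rbrakk> \<Longrightarrow> a \<oplus> b \<notin> Units R"
    and nonunit_power_dvd:
      "\<lbrakk>a \<in> carrier R; a \<noteq> \<zero>; z \<in> carrier R; z \<notin> Units R\<rbrakk>
         \<Longrightarrow> \<exists>K s. s \<in> carrier R \<and> z [^] (K::nat) = a \<otimes> s"
    and exists_nonzero_nonunit: "\<exists>p\<in>carrier R. p \<noteq> \<zero> \<and> p \<notin> Units R"
begin

lemma primeideal_nonunits: "primeideal (carrier R - Units R) R"
proof (rule primeidealI)
  have closed: "a \<otimes> x \<notin> Units R" "x \<otimes> a \<notin> Units R"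
    if "a \<in> carrier R" "a \<notin> Units R" "x \<in> carrier R" for a x
    using that unit_factor[of a x] m_comm[of x a] by auto
  show "ideal (carrier R - Units R) R"
  proof (rule idealI)
    show "subgroup (carrier R - Units R) (add_monoid R)"
    proof (rule group.subgroupI[OF a_group])
      show "carrier R - Units R \<noteq> {}" using exists_nonzero_nonunit by blast
      fix a assume a: "a \<in> carrier R - Units R"
      have "\<ominus> a = a \<otimes> (\<ominus> \<one>)" using a by (simp add: r_minus)
      then have "\<ominus> a \<in> carrier R - Units R" using a closed(1)[of a "\<ominus> \<one>"] by simp
      then show "inv\<^bsub>add_monoid R\<^esub> a \<in> carrier R - Units R" by (simp add: a_inv_def)
    qed (auto simp: nonunits_add)
  qed (use closed in \<open>auto simp: ring_axioms\<close>)
  show "carrier R \<noteq> carrier R - Units R" by auto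
  show "a \<in> carrier R - Units R \<or> b \<in> carrier R - Units R"
    if "a \<in> carrier R" "b \<in> carrier R" "a \<otimes> b \<in> carrier R - Units R" for a b
    using that by auto
qed (rule is_cring)

lemma primeideal_subset_nonunits:
  assumes "primeideal P R"
  shows "P \<subseteq> carrier R - Units R"
proof -
  interpret P: primeideal P R by fact
  have "u \<notin> Units R" if "u \<in> P" for u
  proof
    assume u: "u \<in> Units R"
    have "inv u \<otimes> u \<in> P" using that u by (intro P.I_l_closed) auto
    then have "\<one> \<in> P" using u by simp
    then show False using P.one_imp_carrier P.I_notcarr by blast
  qed
  then show ?thesis using P.a_subset by blast
qed

text \<open>A nonzero prime ideal contains a power of every nonunit, hence every nonunit; the chains of
  primes are therefore no longer than $0 \subset \mathfrak{m}$.\<close>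

lemma nonzero_primeideal_eq_nonunits:
  assumes P: "primeideal P R" and a: "a \<in> P" "a \<noteq> \<zero>"
  shows "P = carrier R - Units R"
proof
  interpret P: primeideal P R by fact
  show "carrier R - Units R \<subseteq> P"
  proof
    fix z assume z: "z \<in> carrier R - Units R"
    have "z [^] K \<in> P \<Longrightarrow> z \<in> P" for K :: nat
    proof (induction K)
      case 0
      then show ?case using P.one_imp_carrier P.I_notcarr by auto
    next
      case (Suc K)
      then show ?case using P.I_prime[of "z [^] K" z] z by auto
    qed
    moreover obtain K :: nat and s where "s \<in> carrier R" "z [^] K = a \<otimes> s"
      using nonunit_power_dvd[of a z] a z P.a_subset by blast
    ultimately show "z \<in> P" using a P.I_r_closed by metis
  qed
qed (rule primeideal_subset_nonunits[OF P])

lemma krull_dim_eq_1: "krull_dim R = 1"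
proof -
  let ?chain = "\<lambda>d P. (\<forall>i\<le>d. primeideal (P i) R) \<and> (\<forall>i<d. P i \<subset> P (Suc i))"
  have dim_le: "d \<le> 1" if P: "?chain d P" for d :: nat and P :: "nat \<Rightarrow> 'a set"
  proof (rule ccontr)
    assume "\<not> d \<le> 1"
    then have pr: "primeideal (P 0) R" "primeideal (P 1) R" "primeideal (P 2) R"
      and strict: "P 0 \<subset> P 1" "P 1 \<subset> P 2"
      using P by (auto simp: numeral_2_eq_2)
    interpret P0: primeideal "P 0" R by (rule pr)
    obtain a where "a \<in> P 1" "a \<noteq> \<zero>" using strict(1) P0.zero_closed by blast
    then show False
      using nonzero_primeideal_eq_nonunits[OF pr(2)] primeideal_subset_nonunits[OF pr(3)] strict(2)
      by blast
  qed
  have "{\<zero>} \<subset> carrier R - Units R"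
    using primeideal_subset_nonunits[OF zeroprimeideal] exists_nonzero_nonunit by blast
  then have "?chain 1 (\<lambda>i. if i = 0 then {\<zero>} else carrier R - Units R)"
    using primeideal_nonunits zeroprimeideal by simp
  then have "\<exists>P. ?chain (1::nat) P"
    by (rule exI[of "?chain 1" "\<lambda>i. if i = 0 then {\<zero>} else carrier R - Units R"])
  then have "enat 1 \<le> krull_dim R"
    unfolding krull_dim_def by (intro Sup_upper CollectI exI[of _ 1] conjI) (rule refl)
  then show ?thesis
  proof (intro antisym)
    show "krull_dim R \<le> 1"
      unfolding krull_dim_def
    proof (rule Sup_least)
      fix e assume "e \<in> {enat d | d. \<exists>P. ?chain d P}"
      then obtain d P where "e = enat d" "?chain d P" by blast
      then show "e \<le> 1" using dim_le[of d P] by (simp add: one_enat_def)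
    qed
  qed (simp add: one_enat_def)
qed

text \<open>Depth one provides a nonunit \<open>z\<close> that is a nonzerodivisor on \<open>M\<close>. A nonzero \<open>r\<close>
  divides a power of \<open>z\<close>, so it cannot kill a nonzero element either.\<close>

lemma MCM_module_torsion_free:
  assumes "MCM_module R M"
  shows "torsion_free R M"
proof -
  interpret M: module R M using assms by (simp add: MCM_module_def fin_gen_module_def)
  have "\<exists>xs. regular_sequence R M xs \<and> xs \<noteq> []"
  proof (rule ccontr)
    assume "\<not> ?thesis"
    then have "module_depth R M \<le> 0"
      unfolding module_depth_def by (intro Sup_least) (auto simp: zero_enat_def)
    then show False using assms by (simp add: MCM_module_def krull_dim_eq_1)
  qed
  then obtain xs where xs: "regular_sequence R M xs" "xs \<noteq> []" by blast
  define z where "z = xs ! 0"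
  have sub: "set xs \<subseteq> carrier R"
    and nzd_all: "\<And>i. i < length xs \<Longrightarrow>
      nonzerodivisor_on (quotient_module M (mult_submodule R M (set (take i xs)))) (xs ! i)"
    using xs(1) by (simp_all add: regular_sequence_def)
  have z: "z \<in> set xs" "z \<in> carrier R" using xs(2) sub by (auto simp: z_def)
  have "nonzerodivisor_on (quotient_module M {\<zero>\<^bsub>M\<^esub>}) z"
    using nzd_all[of 0] xs(2) by (simp add: z_def M.mult_submodule_empty)
  then have nzd: "m = \<zero>\<^bsub>M\<^esub>" if "m \<in> carrier M" "z \<odot>\<^bsub>M\<^esub> m = \<zero>\<^bsub>M\<^esub>" for m
    using that nonzerodivisor_on_quotient_module_iff[OF M.module_axioms M.submodule_zero z(2)] by blast
  have nzd_power: "z [^] K \<odot>\<^bsub>M\<^esub> m = \<zero>\<^bsub>M\<^esub> \<Longrightarrow> m = \<zero>\<^bsub>M\<^esub>" if m: "m \<in> carrier M" for m and K :: nat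
  proof (induction K)
    case (Suc K)
    then show ?case
      using nzd[of "z [^] K \<odot>\<^bsub>M\<^esub> m"] z m by (simp add: m_comm[of _ z] M.smult_assoc1)
  qed (use m in simp)
  show ?thesis
    unfolding torsion_free_def
  proof (intro ballI impI)
    fix r m assume r: "r \<in> carrier R" and m: "m \<in> carrier M" and rm: "r \<odot>\<^bsub>M\<^esub> m = \<zero>\<^bsub>M\<^esub>"
    show "r = \<zero> \<or> m = \<zero>\<^bsub>M\<^esub>"
    proof (cases "r = \<zero>")
      case False
      then obtain K :: nat and s where s: "s \<in> carrier R" "z [^] K = r \<otimes> s"
        using nonunit_power_dvd[OF r _ z(2)] M.regular_sequence_nonunit[OF xs(1) z(1)] by blast
      then have "z [^] K \<odot>\<^bsub>M\<^esub> m = s \<odot>\<^bsub>M\<^esub> (r \<odot>\<^bsub>M\<^esub> m)"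
        using r m by (simp add: m_comm[of r s] M.smult_assoc1)
      then show ?thesis using nzd_power[OF m, of K] rm s(1) by simp
    qed simp
  qed
qed

text \<open>For the converse, \<open>p\<close> alone is a regular sequence: \<open>M\<close> is torsion-free, and
  \<open>m0\<close> shows that $pM \neq M$. No regular sequence has two terms $z_0, z_1$, since a power of $z_1$
  lies in $z_0 R$ and so $z_1$ acts nilpotently on the nonzero module $M/z_0M$.\<close>

lemma MCM_moduleI:
  assumes fg: "fin_gen_module R M" and tf: "torsion_free R M"
    and p: "p \<in> carrier R" "p \<noteq> \<zero>"
    and m0: "m0 \<in> carrier M" "\<And>m. m \<in> carrier M \<Longrightarrow> m0 \<noteq> p \<odot>\<^bsub>M\<^esub> m"
  shows "MCM_module R M"
proof -
  interpret M: module R M using fg by (simp add: fin_gen_module_def)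
  have nz: "m0 \<noteq> \<zero>\<^bsub>M\<^esub>" using m0 p by (metis M.M.zero_closed M.smult_r_null)
  have "m0 \<notin> mult_submodule R M {p}"
    using m0(2) by (auto simp: M.mult_submodule_singleton[OF p(1)])
  moreover have "nonzerodivisor_on (quotient_module M {\<zero>\<^bsub>M\<^esub>}) p"
    unfolding nonzerodivisor_on_quotient_module_iff[OF M.module_axioms M.submodule_zero p(1)]
    using p tf by (auto simp: torsion_free_def)
  ultimately have reg: "regular_sequence R M [p]"
    using p m0(1) by (auto simp: regular_sequence_def M.mult_submodule_empty)
  have length_le: "length xs \<le> 1" if xs: "regular_sequence R M xs" for xs
  proof (rule ccontr)
    assume "\<not> ?thesis"
    then have len: "length xs > 1" by simp
    define z0 z1 where "z0 = xs ! 0" and "z1 = xs ! 1"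
    have sub: "set xs \<subseteq> carrier R"
      and nzd_all: "\<And>i. i < length xs \<Longrightarrow>
        nonzerodivisor_on (quotient_module M (mult_submodule R M (set (take i xs)))) (xs ! i)"
      using xs by (simp_all add: regular_sequence_def)
    have set: "z0 \<in> set xs" "z1 \<in> set xs"
      unfolding z0_def z1_def using len by (auto intro: nth_mem)
    then have c: "z0 \<in> carrier R" "z1 \<in> carrier R" using sub by auto
    have t1: "take 1 xs = [z0]" using len by (cases xs) (auto simp: z0_def)
    define N where "N = mult_submodule R M {z0}"
    have N: "submodule N R M" unfolding N_def by (rule M.submodule_mult_submodule) (use c in simp)
    have "nonzerodivisor_on (quotient_module M {\<zero>\<^bsub>M\<^esub>}) z0"
      using nzd_all[of 0] len by (cases xs) (auto simp: z0_def M.mult_submodule_empty)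
    then have "z0 \<noteq> \<zero>"
      using nonzerodivisor_on_quotient_module_iff[OF M.module_axioms M.submodule_zero c(1)] m0(1) nz
      by auto
    then obtain K :: nat and s where s: "s \<in> carrier R" "z1 [^] K = z0 \<otimes> s"
      using nonunit_power_dvd c M.regular_sequence_nonunit[OF xs set(2)] by blast
    have "nonzerodivisor_on (quotient_module M N) z1"
      using nzd_all[of 1] len t1 by (simp add: z1_def N_def)
    then have nzd: "m \<in> N" if "m \<in> carrier M" "z1 \<odot>\<^bsub>M\<^esub> m \<in> N" for m
      using that nonzerodivisor_on_quotient_module_iff[OF M.module_axioms N c(2)] by blast
    have nzd_power: "z1 [^] k \<odot>\<^bsub>M\<^esub> m \<in> N \<Longrightarrow> m \<in> N" if m: "m \<in> carrier M" for m and k :: nat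
    proof (induction k)
      case (Suc k)
      then show ?case
        using nzd[of "z1 [^] k \<odot>\<^bsub>M\<^esub> m"] c m by (simp add: m_comm[of _ z1] M.smult_assoc1)
    qed (use m in simp)
    have "m \<in> N" if m: "m \<in> carrier M" for m
    proof (rule nzd_power[OF m, of K])
      have "z1 [^] K \<odot>\<^bsub>M\<^esub> m = z0 \<odot>\<^bsub>M\<^esub> (s \<odot>\<^bsub>M\<^esub> m)" using s c m by (simp add: M.smult_assoc1)
      then show "z1 [^] K \<odot>\<^bsub>M\<^esub> m \<in> N"
        using M.smult_in_mult_submodule[of z0 "{z0}"] s m by (simp add: N_def)
    qed
    moreover have "N \<subseteq> mult_submodule R M (set xs)"
      unfolding N_def by (rule M.mult_submodule_mono) (use set in simp)
    moreover have "mult_submodule R M (set xs) \<subseteq> carrier M"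
      using M.submoduleE(1)[OF M.submodule_mult_submodule[OF sub]] .
    ultimately show False using xs by (auto simp: regular_sequence_def)
  qed
  have "module_depth R M \<le> 1"
    unfolding module_depth_def
  proof (rule Sup_least)
    fix e assume "e \<in> {enat (length xs) | xs. regular_sequence R M xs}"
    then obtain xs where "e = enat (length xs)" "regular_sequence R M xs" by blast
    then show "e \<le> 1" using length_le[of xs] by (simp add: one_enat_def)
  qed
  moreover have "enat (length [p]) \<le> module_depth R M"
    unfolding module_depth_def using reg by (intro Sup_upper CollectI exI[of _ "[p]"] conjI refl)
  ultimately have "module_depth R M = 1"
    by (intro antisym) (auto simp: one_enat_def)
  then show ?thesis
    using fg m0(1) nz by (auto simp: MCM_module_def krull_dim_eq_1)
qed

end

section \<open>Norm, valuation and conductor of the curve\<close>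

lemma fps_X_power_dvd_iff: "fps_X ^ k dvd f \<longleftrightarrow> f = 0 \<or> k \<le> subdegree f"
  for f :: "'k::field fps"
  by (cases "f = 0") (auto simp: fps_dvd_iff fps_X_power_subdegree)

text \<open>The norm of $a + b y$ over $k[[x]]$, where $y^2 = -x^n$. For $n = 2m+1$ put
  $t = y / x^m$, so that $t^2 = -x$ and \<open>y\<close> has order \<open>n\<close> in \<open>t\<close>. The order of the norm
  in \<open>x\<close> is then the order of $a + b y$ in \<open>t\<close>: it plays the part of the valuation of the
  normalization $k[[t]]$.\<close>

definition curve_norm :: "nat \<Rightarrow> 'k::field fps \<Rightarrow> 'k fps \<Rightarrow> 'k fps" where
  "curve_norm n a b = a ^ 2 + fps_X ^ n * b ^ 2"

lemma curve_norm_mult: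
  "curve_norm n (a * c - fps_X ^ n * (b * d)) (a * d + b * c) = curve_norm n a b * curve_norm n c d"
  by (simp add: curve_norm_def power2_eq_square algebra_simps)

text \<open>The orders of $a^2$ and $x^n b^2$ have different parities, so the two terms cannot cancel.\<close>

lemma fps_X_power_dvd_curve_norm:
  fixes a b :: "'k::field fps"
  assumes "odd n" "fps_X ^ k dvd curve_norm n a b"
  shows "fps_X ^ k dvd a ^ 2" "fps_X ^ k dvd fps_X ^ n * b ^ 2"
proof -
  have "fps_X ^ k dvd a ^ 2 \<and> fps_X ^ k dvd fps_X ^ n * b ^ 2"
  proof (cases "a = 0 \<or> b = 0")
    case True
    then show ?thesis using assms(2) by (auto simp: curve_norm_def)
  next
    case False
    let ?A = "a ^ 2" and ?B = "fps_X ^ n * b ^ 2"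
    have nz: "?A \<noteq> 0" "?B \<noteq> 0" using False by auto
    have sd: "subdegree ?A = 2 * subdegree a" "subdegree ?B = n + 2 * subdegree b"
      using False by (simp_all add: fps_X_power_subdegree)
    then have "subdegree ?A \<noteq> subdegree ?B" using assms(1) by presburger
    then have "?A + ?B \<noteq> 0"
      by (metis add_eq_0_iff subdegree_uminus)
    moreover have "subdegree (?A + ?B) = min (subdegree ?A) (subdegree ?B)"
    proof (cases "subdegree ?A < subdegree ?B")
      case True
      then show ?thesis using subdegree_add_eq1[OF nz(1) True] by simp
    next
      case False
      then have "subdegree ?B < subdegree ?A" using \<open>subdegree ?A \<noteq> subdegree ?B\<close> by simp
      then show ?thesis using subdegree_add_eq2[OF nz(2)] by simp
    qed
    ultimately have "k \<le> min (subdegree ?A) (subdegree ?B)"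
      using assms(2) by (simp only: curve_norm_def fps_X_power_dvd_iff) simp
    then show ?thesis by (simp add: fps_X_power_dvd_iff)
  qed
  then show "fps_X ^ k dvd a ^ 2" "fps_X ^ k dvd fps_X ^ n * b ^ 2" by blast+
qed

lemma curve_norm_eq_0_iff:
  assumes "odd n"
  shows "curve_norm n a b = 0 \<longleftrightarrow> a = 0 \<and> b = 0"
proof
  assume "curve_norm n a b = 0"
  then have "fps_X ^ k dvd a ^ 2" "fps_X ^ k dvd fps_X ^ n * b ^ 2" for k
    using fps_X_power_dvd_curve_norm[OF assms, of k a b] by auto
  from this(1)[of "Suc (subdegree (a ^ 2))"] this(2)[of "Suc (subdegree (fps_X ^ n * b ^ 2))"]
  show "a = 0 \<and> b = 0" unfolding fps_X_power_dvd_iff by simp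
qed (simp add: curve_norm_def)

lemma curve_norm_nth_0: "n > 0 \<Longrightarrow> curve_norm n a b $ 0 = (a $ 0) ^ 2"
  by (simp add: curve_norm_def power2_eq_square)

text \<open>The ring \<open>R\<close> is $k[[x]] \oplus k[[x]]\,y$ with $y^2 = -x^n$, and $e(a,b)$ stands for
  $a + b y$. Keeping \<open>R\<close> abstract hides the cosets that make up the quotient ring.\<close>

locale curve_coords = cring R for R (structure) +
  fixes e :: "'k::field fps \<Rightarrow> 'k fps \<Rightarrow> 'a" and n :: nat
  assumes odd_n: "odd n"
    and e_closed [simp, intro]: "e a b \<in> carrier R"
    and e_surj: "r \<in> carrier R \<Longrightarrow> \<exists>a b. r = e a b"
    and e_eq_iff [simp]: "e a b = e c d \<longleftrightarrow> a = c \<and> b = d"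
    and e_add [simp]: "e a b \<oplus> e c d = e (a + c) (b + d)"
    and e_mult [simp]: "e a b \<otimes> e c d = e (a * c - fps_X ^ n * (b * d)) (a * d + b * c)"
    and zero_e: "\<zero> = e 0 0"
    and one_e: "\<one> = e 1 0"
begin

lemma n_pos: "n > 0" using odd_n by (rule odd_pos)

lemma e_minus [simp]: "\<ominus> e a b = e (- a) (- b)"
  by (rule minus_equality) (simp_all add: zero_e)

lemma e_power: "e a 0 [^] (j::nat) = e (a ^ j) 0"
  by (induction j) (simp_all add: one_e mult.commute)

sublocale domain R
proof unfold_locales
  show "\<one> \<noteq> \<zero>" by (simp add: one_e zero_e)
  fix r s assume rs: "r \<otimes> s = \<zero>" "r \<in> carrier R" "s \<in> carrier R"
  then obtain a b c d where r: "r = e a b" "s = e c d" using e_surj by meson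
  then have "curve_norm n a b * curve_norm n c d = curve_norm n 0 0"
    using rs(1) by (simp add: zero_e flip: curve_norm_mult)
  then have "curve_norm n a b = 0 \<or> curve_norm n c d = 0" by (simp add: curve_norm_def)
  then show "r = \<zero> \<or> s = \<zero>" by (auto simp: r zero_e curve_norm_eq_0_iff[OF odd_n])
qed

text \<open>The conjugate of $a + b y$ is $a - b y$; the factor \<open>v\<close> serves to scale the norm to a unit
  or to a power of \<open>x\<close>.\<close>

lemma e_times_conjugate: "e a b \<otimes> e (a * v) (- b * v) = e (curve_norm n a b * v) 0"
  by (simp add: curve_norm_def power2_eq_square algebra_simps)

lemma Units_iff: "e a b \<in> Units R \<longleftrightarrow> a $ 0 \<noteq> 0"
proof
  assume "e a b \<in> Units R"
  then obtain r where r: "r \<in> carrier R" "e a b \<otimes> r = \<one>" by (auto simp: Units_def)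
  then obtain c d where cd: "r = e c d" using e_surj by blast
  have "curve_norm n a b * curve_norm n c d = curve_norm n 1 0"
    using r(2) by (simp add: cd one_e flip: curve_norm_mult)
  then have "(curve_norm n a b * curve_norm n c d) $ 0 = 1" by (simp add: curve_norm_def)
  then show "a $ 0 \<noteq> 0" by (auto simp: curve_norm_nth_0[OF n_pos])
next
  assume "a $ 0 \<noteq> 0"
  then have "curve_norm n a b * inverse (curve_norm n a b) = 1"
    by (intro inverse_mult_eq_1') (simp add: curve_norm_nth_0[OF n_pos])
  then have unit: "e a b \<otimes> e (a * inverse (curve_norm n a b)) (- b * inverse (curve_norm n a b)) = \<one>"
    unfolding e_times_conjugate by (simp only: one_e)
  moreover note trans[OF m_comm[OF e_closed e_closed] unit]
  ultimately show "e a b \<in> Units R"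
    unfolding Units_def by (intro CollectI conjI e_closed bexI[OF _ e_closed])
qed

text \<open>The elements $f + g y$ with $x^m \mid f$ form the conductor of \<open>R\<close> in $k[[t]]$: such an
  element times a quotient $r/s$ of nonnegative order is back in \<open>R\<close>. Concretely, multiplying
  the numerator by the conjugate of \<open>s\<close> turns the denominator into the norm of \<open>s\<close>, which is
  $x^i$ up to a unit, and the norm of the new numerator is divisible by $x^{2(m+i)}$. This forces
  both of its coordinates to be divisible by $x^i$.\<close>

lemma dvd_of_curve_norm_dvd:
  assumes n: "n = 2 * m + 1"
    and s: "e a b \<noteq> \<zero>" and dvd: "curve_norm n a b dvd curve_norm n c d"
    and f: "fps_X ^ m dvd f"
  shows "\<exists>t\<in>carrier R. e a b \<otimes> t = e f g \<otimes> e c d"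
proof -
  define N where "N = curve_norm n a b"
  define i where "i = subdegree N"
  have N0: "N \<noteq> 0" using s by (simp add: N_def zero_e curve_norm_eq_0_iff[OF odd_n])
  have N_dvd: "N dvd p" if "fps_X ^ i dvd p" for p
    using that N0 by (cases "p = 0") (auto simp: fps_X_power_dvd_iff fps_dvd_iff i_def)
  have iN: "fps_X ^ i dvd N" by (simp add: fps_X_power_dvd_iff i_def)
  obtain p q where pq: "e f g \<otimes> e c d \<otimes> e a (- b) = e p q" by simp
  obtain f' where "f = fps_X ^ m * f'" using f by (elim dvdE)
  then have "f ^ 2 = fps_X ^ (2 * m) * f' ^ 2"
    by (simp add: power_mult_distrib power_mult [symmetric] mult.commute)
  moreover have "fps_X ^ n * g ^ 2 = fps_X ^ (2 * m) * (fps_X * g ^ 2)"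
    by (simp add: n mult_ac)
  ultimately have "fps_X ^ (2 * m) dvd curve_norm n f g"
    unfolding curve_norm_def by (metis dvd_add dvd_triv_left)
  moreover have "fps_X ^ i dvd curve_norm n c d" using iN dvd by (auto simp: N_def)
  moreover have "fps_X ^ i dvd curve_norm n a (- b)" using iN by (simp add: N_def curve_norm_def)
  ultimately have "fps_X ^ (2 * m) * fps_X ^ i * fps_X ^ i
      dvd curve_norm n f g * curve_norm n c d * curve_norm n a (- b)"
    by (intro mult_dvd_mono)
  moreover have "curve_norm n f g * curve_norm n c d * curve_norm n a (- b) = curve_norm n p q"
    using pq by (simp flip: curve_norm_mult)
  moreover have "2 * (m + i) = 2 * m + i + i" by simp
  ultimately have "fps_X ^ (2 * (m + i)) dvd curve_norm n p q"
    by (simp only: power_add)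
  note * = fps_X_power_dvd_curve_norm[OF odd_n this]
  have "fps_X ^ i dvd p"
    using *(1) by (cases "p = 0") (auto simp: fps_X_power_dvd_iff)
  moreover have "fps_X ^ i dvd q"
    using *(2) by (cases "q = 0") (auto simp: fps_X_power_dvd_iff fps_X_power_subdegree n)
  ultimately obtain p' q' where p': "p = N * p'" "q = N * q'"
    using N_dvd by (meson dvdE)
  have conj0: "e a (- b) \<noteq> \<zero>" using s by (simp add: zero_e)
  have "(e a b \<otimes> e p' q') \<otimes> e a (- b) = (e a b \<otimes> e (a * 1) (- b * 1)) \<otimes> e p' q'"
    using m_comm[of "e p' q'" "e a (- b)"] by (simp only: m_assoc e_closed mult_1_right)
  also have "\<dots> = e f g \<otimes> e c d \<otimes> e a (- b)"
    unfolding e_times_conjugate pq by (simp add: p' N_def)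
  finally have "e a b \<otimes> e p' q' = e f g \<otimes> e c d"
    by (rule m_rcancel[OF conj0, THEN iffD1, rotated -1]) (intro m_closed e_closed)+
  then show ?thesis by (intro bexI[OF _ e_closed])
qed


text \<open>Any nonzero functional can be rescaled to take a prescribed conductor element as a value.
  Let \<open>v\<close> be such that $f(v)$ has the least order among the nonzero values. Then $f / f(v)$ maps
  \<open>M\<close> to $k[[t]]$ and \<open>v\<close> to \<open>1\<close>, and the conductor element times it maps \<open>M\<close> to \<open>R\<close>.\<close>

lemma conductor_functional:
  assumes n: "n = 2 * m + 1" and g: "fps_X ^ m dvd g"
    and M: "module R M" and f: "linear_functional R M f"
    and u: "u \<in> carrier M" "f u \<noteq> \<zero>"
  obtains \<phi> v where "linear_functional R M \<phi>" "v \<in> carrier M" "\<phi> v = e g h"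
proof -
  interpret M: module R M by fact
  have fc: "f w \<in> carrier R" if "w \<in> carrier M" for w
    using f that by (auto simp: linear_functional_def)
  define P where "P k \<longleftrightarrow> (\<exists>v a b. v \<in> carrier M \<and> f v = e a b \<and> e a b \<noteq> \<zero> \<and>
    subdegree (curve_norm n a b) = k)" for k
  have "\<exists>k. P k" using u e_surj[OF fc[OF u(1)]] unfolding P_def by metis
  then obtain k where k: "P k" and least: "\<And>l. P l \<Longrightarrow> k \<le> l"
    using exists_least_iff[of P] by (metis not_less)
  obtain v a b where v: "v \<in> carrier M" "f v = e a b" "e a b \<noteq> \<zero>"
    and ab: "subdegree (curve_norm n a b) = k"
    using k unfolding P_def by blast
  have quot: "\<exists>t\<in>carrier R. e a b \<otimes> t = e g h \<otimes> f w" if w: "w \<in> carrier M" for w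
  proof -
    obtain c d where cd: "f w = e c d" using e_surj[OF fc[OF w]] by blast
    have "curve_norm n a b dvd curve_norm n c d"
    proof (cases "e c d = \<zero>")
      case True
      then show ?thesis by (simp add: zero_e curve_norm_def)
    next
      case False
      then have "k \<le> subdegree (curve_norm n c d)"
        using w cd by (intro least) (auto simp: P_def)
      then show ?thesis
        using v(3) False by (simp add: fps_dvd_iff ab zero_e curve_norm_eq_0_iff[OF odd_n])
    qed
    then show ?thesis using dvd_of_curve_norm_dvd[OF n v(3) _ g, of c d h] by (simp only: cd)
  qed
  define \<phi> where "\<phi> w = (SOME t. t \<in> carrier R \<and> e a b \<otimes> t = e g h \<otimes> f w)" for w
  have \<phi>: "\<phi> w \<in> carrier R" "e a b \<otimes> \<phi> w = e g h \<otimes> f w" if "w \<in> carrier M" for w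
    using someI_ex[of "\<lambda>t. t \<in> carrier R \<and> e a b \<otimes> t = e g h \<otimes> f w"] quot[OF that]
    unfolding \<phi>_def by blast+
  have \<phi>_eq: "\<phi> w = t" if "w \<in> carrier M" "t \<in> carrier R" "e a b \<otimes> t = e g h \<otimes> f w" for w t
    using that \<phi>[OF that(1)] m_lcancel[OF v(3) e_closed, of "\<phi> w" t] by simp
  have "linear_functional R M \<phi>"
    unfolding linear_functional_def
  proof (intro conjI ballI funcsetI)
    fix w w' assume w: "w \<in> carrier M" "w' \<in> carrier M"
    have "e a b \<otimes> (\<phi> w \<oplus> \<phi> w') = e g h \<otimes> f w \<oplus> e g h \<otimes> f w'"
      using w by (simp only: r_distr e_closed \<phi>)
    also have "\<dots> = e g h \<otimes> f (w \<oplus>\<^bsub>M\<^esub> w')"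
      using f w fc by (simp add: linear_functional_def r_distr del: e_mult)
    finally show "\<phi> (w \<oplus>\<^bsub>M\<^esub> w') = \<phi> w \<oplus> \<phi> w'"
      using w \<phi> by (intro \<phi>_eq) auto
  next
    fix r w assume r: "r \<in> carrier R" and w: "w \<in> carrier M"
    have "e a b \<otimes> (r \<otimes> \<phi> w) = r \<otimes> (e g h \<otimes> f w)"
      using r w m_lcomm[of "e a b" r "\<phi> w"] by (simp only: e_closed \<phi>)
    also have "\<dots> = e g h \<otimes> f (r \<odot>\<^bsub>M\<^esub> w)"
      using f w r fc m_lcomm[of r "e g h" "f w"] by (simp add: linear_functional_def del: e_mult)
    finally show "\<phi> (r \<odot>\<^bsub>M\<^esub> w) = r \<otimes> \<phi> w"
      using w r \<phi> by (intro \<phi>_eq) auto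
  qed (use \<phi> in auto)
  moreover have "\<phi> v = e g h"
    using v(1) m_comm[OF e_closed e_closed, of a b g h] by (intro \<phi>_eq) (simp_all only: v(2) e_closed)
  ultimately show thesis using that v(1) by blast
qed

end

section \<open>The ideals $(x^j, y)$ and their test ideals\<close>

context curve_coords
begin

text \<open>If $r \neq 0$ has norm of order \<open>i\<close>, then \<open>r\<close> divides $x^i$; the square of a nonunit is
  divisible by \<open>x\<close>, so its power with exponent $2i$ is divisible by \<open>r\<close>.\<close>

sublocale one_dim_local_domain R
proof unfold_locales
  fix a b assume a: "a \<in> carrier R" "a \<notin> Units R" and b: "b \<in> carrier R" "b \<notin> Units R"
  obtain a1 a2 b1 b2 where "a = e a1 a2" "b = e b1 b2" using e_surj a b by meson
  then show "a \<oplus> b \<notin> Units R" using a b by (simp add: Units_iff)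
next
  show "\<exists>p\<in>carrier R. p \<noteq> \<zero> \<and> p \<notin> Units R"
    by (intro bexI[of _ "e fps_X 0"]) (simp_all add: zero_e Units_iff)
next
  fix r z assume r: "r \<in> carrier R" "r \<noteq> \<zero>" and z: "z \<in> carrier R" "z \<notin> Units R"
  obtain a b c d where ab: "r = e a b" and cd: "z = e c d" using e_surj r(1) z(1) by meson
  define i where "i = subdegree (curve_norm n a b)"
  have "curve_norm n a b \<noteq> 0" using r by (simp add: ab zero_e curve_norm_eq_0_iff[OF odd_n])
  then have "curve_norm n a b dvd fps_X ^ i" by (simp add: fps_dvd_iff fps_X_power_subdegree i_def)
  then obtain v where v: "fps_X ^ i = curve_norm n a b * v" by (elim dvdE)
  have "c $ 0 = 0" using z by (simp add: cd Units_iff)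
  then have "fps_X dvd c"
    using fps_X_power_dvd_iff[of 1 c] subdegree_eq_0_iff[of c] by (cases "c = 0") auto
  then obtain c' where c': "c = fps_X * c'" by (elim dvdE)
  obtain k where k: "n = Suc k" using n_pos by (cases n) auto
  define w where "w = e (c' * c - fps_X ^ k * (d * d)) (2 * c' * d)"
  have "z \<otimes> z = e fps_X 0 \<otimes> w"
    by (simp add: cd c' w_def k algebra_simps)
  have "z [^] (2 * i) = (z \<otimes> z) [^] i"
    using z(1) nat_pow_pow[of z 2 i] by (simp add: numeral_2_eq_2)
  also have "\<dots> = e (fps_X ^ i) 0 \<otimes> w [^] i"
    using \<open>z \<otimes> z = _\<close> nat_pow_distrib[of "e fps_X 0" w i] by (simp add: w_def e_power del: e_mult)
  also have "e (fps_X ^ i) 0 = r \<otimes> e (a * v) (- b * v)"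
    unfolding ab e_times_conjugate by (simp only: v)
  finally have "z [^] (2 * i) = r \<otimes> (e (a * v) (- b * v) \<otimes> w [^] i)"
    using r(1) by (simp add: m_assoc w_def del: e_mult)
  moreover have "e (a * v) (- b * v) \<otimes> w [^] i \<in> carrier R" by (simp add: w_def del: e_mult)
  ultimately show "\<exists>K s. s \<in> carrier R \<and> z [^] (K::nat) = r \<otimes> s" by blast
qed

text \<open>The ideal $(x^j, y)$ for $j \le n$, in coordinates.\<close>

definition branch_ideal :: "nat \<Rightarrow> 'a set" where
  "branch_ideal j = {e a b | a b. fps_X ^ j dvd a}"

lemma e_in_branch_ideal_iff [simp]: "e a b \<in> branch_ideal j \<longleftrightarrow> fps_X ^ j dvd a"
  by (auto simp: branch_ideal_def)

lemma branch_idealE: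
  assumes "u \<in> branch_ideal j"
  obtains a b where "u = e (fps_X ^ j * a) b"
  using assms by (auto simp: branch_ideal_def)

lemma ideal_branch_ideal:
  assumes "j \<le> n"
  shows "ideal (branch_ideal j) R"
proof (rule idealI)
  have X: "fps_X ^ j dvd (fps_X ^ n :: 'k fps)" using assms by (rule le_imp_power_dvd)
  show "subgroup (branch_ideal j) (add_monoid R)"
  proof (rule group.subgroupI[OF a_group])
    show "branch_ideal j \<noteq> {}" using e_in_branch_ideal_iff[of 0 0 j] by (metis dvd_0_right empty_iff)
    show "inv\<^bsub>add_monoid R\<^esub> u \<in> branch_ideal j" if "u \<in> branch_ideal j" for u
      using that by (auto simp: branch_ideal_def simp flip: a_inv_def)
  qed (auto simp: branch_ideal_def)
  fix u r assume u: "u \<in> branch_ideal j" and r: "r \<in> carrier R"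
  obtain a b c d where "u = e (fps_X ^ j * a) b" "r = e c d"
    using branch_idealE[OF u] e_surj[OF r] by metis
  then show "r \<otimes> u \<in> branch_ideal j" "u \<otimes> r \<in> branch_ideal j"
    using X by (auto intro!: dvd_diff)
qed (rule ring_axioms)

lemma branch_ideal_eq_genideal:
  assumes "j \<le> n"
  shows "Idl {e (fps_X ^ j) 0, e 0 1} = branch_ideal j"
proof
  show "Idl {e (fps_X ^ j) 0, e 0 1} \<subseteq> branch_ideal j"
    by (rule genideal_minimal[OF ideal_branch_ideal[OF assms]]) simp
  interpret I: ideal "Idl {e (fps_X ^ j) 0, e 0 1}" R by (rule genideal_ideal) simp
  have gen: "e (fps_X ^ j) 0 \<in> Idl {e (fps_X ^ j) 0, e 0 1}" "e 0 1 \<in> Idl {e (fps_X ^ j) 0, e 0 1}"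
    using genideal_self[of "{e (fps_X ^ j) 0, e 0 1}"] by auto
  show "branch_ideal j \<subseteq> Idl {e (fps_X ^ j) 0, e 0 1}"
  proof
    fix u assume "u \<in> branch_ideal j"
    then obtain a b where u: "u = e (fps_X ^ j * a) b" by (rule branch_idealE)
    have "e a 0 \<otimes> e (fps_X ^ j) 0 \<oplus> e b 0 \<otimes> e 0 1 \<in> Idl {e (fps_X ^ j) 0, e 0 1}"
      using gen by (intro I.a_closed I.I_l_closed e_closed)
    moreover have "e a 0 \<otimes> e (fps_X ^ j) 0 \<oplus> e b 0 \<otimes> e 0 1 = u"
      by (simp add: u mult.commute)
    ultimately show "u \<in> Idl {e (fps_X ^ j) 0, e 0 1}" by simp
  qed
qed

text \<open>From $y \cdot x^j = x^j \cdot y$ and $y \cdot y = -x^n = x^j \cdot (-x^{n-j})$: here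
  $x^{n-j}$ must lie in the ideal again, whence $2j \le n$.\<close>

lemma y_times_branch_ideal:
  assumes "2 * j \<le> n" "u \<in> branch_ideal j"
  obtains u' where "u' \<in> branch_ideal j" "e 0 1 \<otimes> u = e (fps_X ^ j) 0 \<otimes> u'"
proof -
  obtain a b where u: "u = e (fps_X ^ j * a) b" using branch_idealE[OF assms(2)] .
  have "fps_X ^ n = fps_X ^ j * (fps_X ^ (n - j) :: 'k fps)"
    using assms(1) by (simp flip: power_add)
  then have "e 0 1 \<otimes> u = e (fps_X ^ j) 0 \<otimes> e (- (fps_X ^ (n - j) * b)) a"
    by (simp add: u mult.assoc)
  moreover have "fps_X ^ j dvd (fps_X ^ (n - j) :: 'k fps)"
    using assms(1) by (intro le_imp_power_dvd) simp
  then have "e (- (fps_X ^ (n - j) * b)) a \<in> branch_ideal j" by simp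
  ultimately show thesis using that by blast
qed

text \<open>Since $(p + q y) y = -x^n q + p y$ is divisible by $x^j$ only if \<open>p\<close> is, the colon ideal
  $(x^j R : y)$ consists of elements $p + q y$ with $x^j \mid p$.\<close>

lemma test_ideal_subset_branch_ideal:
  fixes \<kappa> :: "'a \<Rightarrow> 'u"
  assumes M: "module R M" and \<kappa>: "inj_on \<kappa> (carrier R)"
    and ym: "\<And>m. m \<in> carrier M \<Longrightarrow> \<exists>m'\<in>carrier M. e 0 1 \<odot>\<^bsub>M\<^esub> m = e (fps_X ^ j) 0 \<odot>\<^bsub>M\<^esub> m'"
  shows "test_ideal TYPE('u) R M \<subseteq> branch_ideal j"
proof
  fix r assume r: "r \<in> test_ideal TYPE('u) R M"
  obtain p q where pq: "r = e p q" using e_surj r unfolding test_ideal_def by blast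
  obtain s where s: "s \<in> carrier R" "r \<otimes> e 0 1 = e (fps_X ^ j) 0 \<otimes> s"
    using test_ideal_times_subset[OF M \<kappa> e_closed e_closed ym r] by blast
  obtain c d where "s = e c d" using e_surj[OF s(1)] by blast
  then have "p = fps_X ^ j * d" using s(2) by (simp add: pq)
  then show "r \<in> branch_ideal j" by (simp add: pq)
qed

text \<open>The colon bound from above meets the trace bound from below: the inclusion of the ideal
  into \<open>R\<close> is a functional whose image is the ideal itself.\<close>

lemma test_ideal_branch_ideal:
  fixes \<kappa> :: "'a \<Rightarrow> 'u"
  assumes \<kappa>: "inj_on \<kappa> (carrier R)" and j: "2 * j \<le> n"
  shows "test_ideal TYPE('u) R (ideal_as_module R (branch_ideal j)) = branch_ideal j"
proof
  let ?I = "ideal_as_module R (branch_ideal j)"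
  have "ideal (branch_ideal j) R" using j by (intro ideal_branch_ideal) simp
  then interpret I: ideal "branch_ideal j" R .
  have M: "module R ?I" by (rule module_ideal_as_module[OF is_cring I.ideal_axioms])
  show "test_ideal TYPE('u) R ?I \<subseteq> branch_ideal j"
  proof (rule test_ideal_subset_branch_ideal[OF M \<kappa>])
    fix u assume "u \<in> carrier ?I"
    then have "u \<in> branch_ideal j" by simp
    then obtain u' where "u' \<in> branch_ideal j" "e 0 1 \<otimes> u = e (fps_X ^ j) 0 \<otimes> u'"
      by (rule y_times_branch_ideal[OF j])
    then show "\<exists>u'\<in>carrier ?I. e 0 1 \<odot>\<^bsub>?I\<^esub> u = e (fps_X ^ j) 0 \<odot>\<^bsub>?I\<^esub> u'"
      by (intro bexI[of _ u']) simp_all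
  qed
  have "linear_functional R ?I (\<lambda>u. u)"
    by (auto simp: linear_functional_def I.a_Hcarr)
  then show "branch_ideal j \<subseteq> test_ideal TYPE('u) R ?I"
    using trace_in_test_ideal[OF M, of "\<lambda>u. u"] by auto
qed

text \<open>The ideal is torsion-free with two generators, and \<open>y\<close> is not \<open>x\<close> times an element
  of \<open>R\<close>, so \<open>x\<close> does not map the ideal onto itself.\<close>

lemma MCM_module_copy_branch_ideal:
  fixes \<kappa> :: "'a \<Rightarrow> 'u"
  assumes \<kappa>: "inj_on \<kappa> (carrier R)" and j: "j \<le> n"
  shows "MCM_module R (module_copy \<kappa> (ideal_as_module R (branch_ideal j)))"
proof -
  let ?I = "ideal_as_module R (branch_ideal j)"
  let ?M = "module_copy \<kappa> ?I"
  interpret I: ideal "branch_ideal j" R by (rule ideal_branch_ideal[OF j])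
  have inj: "inj_on \<kappa> (carrier ?I)"
    using \<kappa> by (rule inj_on_subset) (simp add: I.a_subset)
  have M: "module R ?M"
    using module_ideal_as_module[OF is_cring I.ideal_axioms] inj by (rule module_module_copy)
  interpret M: module R ?M by fact
  have add: "\<kappa> u \<oplus>\<^bsub>?M\<^esub> \<kappa> v = \<kappa> (u \<oplus> v)" and smult: "r \<odot>\<^bsub>?M\<^esub> \<kappa> u = \<kappa> (r \<otimes> u)"
    if "u \<in> branch_ideal j" "v \<in> branch_ideal j" for u v r
    using module_copy_ops[OF inj, of u] that by simp_all
  have carr: "carrier ?M = \<kappa> ` branch_ideal j" by simp
  have gen: "e (fps_X ^ j) 0 \<in> branch_ideal j" "e 0 1 \<in> branch_ideal j" by simp_all
  let ?S = "{\<kappa> (e (fps_X ^ j) 0), \<kappa> (e 0 1)}"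
  have S: "?S \<subseteq> carrier ?M" unfolding carr using gen by blast
  have N: "submodule (span_submodule R ?M ?S) R ?M" by (rule M.submodule_span_submodule[OF S])
  have "carrier ?M \<subseteq> span_submodule R ?M ?S"
  proof
    fix w assume "w \<in> carrier ?M"
    then obtain u where "u \<in> branch_ideal j" and w: "w = \<kappa> u" by auto
    then obtain a b where u: "u = e (fps_X ^ j * a) b" by (elim branch_idealE)
    have "e a 0 \<odot>\<^bsub>?M\<^esub> \<kappa> (e (fps_X ^ j) 0) \<oplus>\<^bsub>?M\<^esub> e b 0 \<odot>\<^bsub>?M\<^esub> \<kappa> (e 0 1) \<in> span_submodule R ?M ?S"
      using M.span_submodule_superset[of ?S]
      by (intro M.submoduleE(4,5)[OF N] e_closed) auto
    moreover have "e a 0 \<odot>\<^bsub>?M\<^esub> \<kappa> (e (fps_X ^ j) 0) \<oplus>\<^bsub>?M\<^esub> e b 0 \<odot>\<^bsub>?M\<^esub> \<kappa> (e 0 1) = w"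
      unfolding smult[OF gen] smult[OF gen(2,1)]
      by (subst add) (simp_all add: w u mult.commute)
    ultimately show "w \<in> span_submodule R ?M ?S" by simp
  qed
  then have fg: "fin_gen_module R ?M"
    unfolding fin_gen_module_def using M S M.submoduleE(1)[OF N]
    by (intro conjI exI[of _ ?S] subset_antisym) auto
  have tf: "torsion_free R ?M"
    unfolding torsion_free_def
  proof (intro ballI impI)
    fix r w assume r: "r \<in> carrier R" and "w \<in> carrier ?M" and rw: "r \<odot>\<^bsub>?M\<^esub> w = \<zero>\<^bsub>?M\<^esub>"
    then obtain u where u: "u \<in> branch_ideal j" "w = \<kappa> u" by auto
    then have "\<kappa> (r \<otimes> u) = \<kappa> \<zero>" using rw smult[OF u(1) u(1), of r] by simp
    then have "r \<otimes> u = \<zero>" using \<kappa> r u(1) I.a_Hcarr by (meson inj_onD m_closed zero_closed)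
    then show "r = \<zero> \<or> w = \<zero>\<^bsub>?M\<^esub>" using integral[OF _ r I.a_Hcarr[OF u(1)]] u(2) by auto
  qed
  show ?thesis
  proof (rule MCM_moduleI[OF fg tf, of "e fps_X 0" "\<kappa> (e 0 1)"])
    show "e fps_X 0 \<noteq> \<zero>" by (simp add: zero_e)
    show "\<kappa> (e 0 1) \<in> carrier ?M" unfolding carr using gen(2) by blast
    fix w assume "w \<in> carrier ?M"
    then obtain u where u: "u \<in> branch_ideal j" "w = \<kappa> u" by auto
    then obtain a b where ab: "u = e a b" using e_surj I.a_Hcarr by metis
    have "1 \<noteq> fps_X * b"
    proof
      assume "1 = fps_X * b"
      then have "(1 :: 'k fps) $ 0 = (fps_X * b) $ 0" by (rule arg_cong)
      then show False by simp
    qed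
    then have "e 0 1 \<noteq> e fps_X 0 \<otimes> u" by (simp add: ab)
    moreover have "e fps_X 0 \<otimes> u \<in> carrier R" using u(1) I.a_Hcarr by simp
    ultimately have "\<kappa> (e 0 1) \<noteq> \<kappa> (e fps_X 0 \<otimes> u)"
      using inj_on_eq_iff[OF \<kappa> e_closed] by blast
    then show "\<kappa> (e 0 1) \<noteq> e fps_X 0 \<odot>\<^bsub>?M\<^esub> w" using smult[OF u(1) u(1)] u(2) by simp
  qed simp
qed

text \<open>The MCM module $(x^m, y)$ gives the inclusion from left to right. For the other one, every MCM
  module has a nonzero functional, which can be rescaled to reach each element of the conductor
  $(x^m, y)$.\<close>

lemma tau_MCM_eq_branch_ideal:
  fixes \<kappa> :: "'a \<Rightarrow> 'u"
  assumes \<kappa>: "inj_on \<kappa> (carrier R)" and n: "n = 2 * m + 1"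
  shows "tau_MCM TYPE('u) R = branch_ideal m"
proof
  let ?I = "ideal_as_module R (branch_ideal m)"
  let ?M = "module_copy \<kappa> ?I"
  have mn: "m \<le> n" "2 * m \<le> n" using n by simp_all
  interpret I: ideal "branch_ideal m" R by (rule ideal_branch_ideal[OF mn(1)])
  have inj: "inj_on \<kappa> (carrier ?I)"
    using \<kappa> by (rule inj_on_subset) (simp add: I.a_subset)
  have MCM: "MCM_module R ?M" by (rule MCM_module_copy_branch_ideal[OF \<kappa> mn(1)])
  then have M: "module R ?M" by (simp add: MCM_module_def fin_gen_module_def)
  have "test_ideal TYPE('u) R ?M \<subseteq> branch_ideal m"
  proof (rule test_ideal_subset_branch_ideal[OF M \<kappa>])
    fix w assume "w \<in> carrier ?M"
    then obtain u where u: "u \<in> branch_ideal m" "w = \<kappa> u" by auto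
    obtain u' where u': "u' \<in> branch_ideal m" "e 0 1 \<otimes> u = e (fps_X ^ m) 0 \<otimes> u'"
      using y_times_branch_ideal[OF mn(2) u(1)] .
    then show "\<exists>w'\<in>carrier ?M. e 0 1 \<odot>\<^bsub>?M\<^esub> w = e (fps_X ^ m) 0 \<odot>\<^bsub>?M\<^esub> w'"
      using module_copy_ops(2)[OF inj, of u] module_copy_ops(2)[OF inj, of u'] u
      by (intro bexI[of _ "\<kappa> u'"]) simp_all
  qed
  then show "tau_MCM TYPE('u) R \<subseteq> branch_ideal m"
    using MCM unfolding tau_MCM_def by blast
  show "branch_ideal m \<subseteq> tau_MCM TYPE('u) R"
  proof
    fix c assume c: "c \<in> branch_ideal m"
    then obtain g h where gh: "c = e g h" "fps_X ^ m dvd g" by (auto simp: branch_ideal_def)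
    have "c \<in> test_ideal TYPE('u) R N" if N: "MCM_module R N" for N :: "('a, 'u) module"
    proof -
      have fg: "fin_gen_module R N" and nz: "carrier N \<noteq> {\<zero>\<^bsub>N\<^esub>}" and mod: "module R N"
        using N by (simp_all add: MCM_module_def fin_gen_module_def)
      obtain f u where f: "linear_functional R N f" "u \<in> carrier N" "f u \<noteq> \<zero>"
        using exists_nonzero_functional[OF domain_axioms fg MCM_module_torsion_free[OF N] nz] .
      obtain \<phi> v where "linear_functional R N \<phi>" "v \<in> carrier N" "\<phi> v = c"
        using conductor_functional[OF n gh(2) mod f] unfolding gh(1) .
      then show ?thesis using trace_in_test_ideal[OF mod] by blast
    qed
    then show "c \<in> tau_MCM TYPE('u) R"
      using c I.a_Hcarr by (simp add: tau_MCM_def)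
  qed
qed

end

section \<open>Weierstrass division by $y^2 + w$\<close>


text \<open>The quotient of $\sum_i F_i y^i$ by $y^2 + w$ has coefficients
  $T_i = F_i - w F_{i+2} + w^2 F_{i+4} - \cdots$, shifted by two, and the remainder is
  $T_0 + T_1 y$. The series converges because \<open>w\<close> has no constant term: modulo $x^{d+1}$ only
  the first $d + 1$ terms matter.\<close>

lemma weierstrass_coefficients_exist:
  fixes F :: "'k::field fps fps"
  assumes w: "w $ 0 = 0"
  obtains T where "\<And>i. T i = F $ i - w * T (i + 2)"
proof -
  define S where "S i K = (\<Sum>k\<le>K. (- w) ^ k * F $ (i + 2 * k))" for i K
  define T where "T i = Abs_fps (\<lambda>d. S i d $ d)" for i
  have small: "((- w) ^ k * f) $ d = 0" if "d < k" for k d and f :: "'k fps"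
  proof -
    have "(- w) ^ k $ l = 0" if "l < k" for l
      using w that by (intro startsby_zero_power_prefix[rule_format]) auto
    then show ?thesis using that by (simp add: fps_mult_nth)
  qed
  have S_stable: "S i K $ d = S i d $ d" if "d \<le> K" for i d K
    using that
  proof (induction K rule: dec_induct)
    case (step K)
    then show ?case using small[of d "Suc K"] by (simp add: S_def)
  qed simp
  have S_Suc: "S i (Suc K) = F $ i - w * S (i + 2) K" for i K
  proof -
    have "(\<Sum>k\<le>K. (- w) ^ Suc k * F $ (i + 2 * Suc k)) = - (w * S (i + 2) K)"
      unfolding S_def sum_distrib_left sum_negf[symmetric]
      by (intro sum.cong refl) (simp add: mult.assoc)
    then show ?thesis
      unfolding S_def[of i] sum.atMost_Suc_shift
      by (simp only: power_0 mult_0_right add_0_right mult_1_left diff_conv_add_uminus)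
  qed
  have T_nth: "T i $ d = S i K $ d" if "d \<le> K" for d K i
    by (simp add: T_def S_stable[OF that])
  have "T i = F $ i - w * T (i + 2)" for i
  proof (rule fps_ext)
    fix d
    have "(w * T (i + 2)) $ d = (w * S (i + 2) d) $ d"
      unfolding fps_mult_nth by (intro sum.cong refl) (simp add: T_nth[of _ d])
    moreover have "T i $ d = S i (Suc d) $ d" by (rule T_nth) simp
    ultimately show "T i $ d = (F $ i - w * T (i + 2)) $ d" by (simp add: S_Suc)
  qed
  then show thesis by (rule that)
qed

lemma weierstrass_division_exists:
  fixes F :: "'k::field fps fps"
  assumes w: "w $ 0 = 0"
  obtains G a b where "F = (fps_X ^ 2 + fps_const w) * G + (fps_const a + fps_const b * fps_X)"
proof -
  obtain T where T: "\<And>i. T i = F $ i - w * T (i + 2)"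
    using weierstrass_coefficients_exist[OF w] by blast
  have "F = (fps_X ^ 2 + fps_const w) * Abs_fps (\<lambda>i. T (i + 2))
      + (fps_const (T 0) + fps_const (T 1) * fps_X)"
  proof (rule fps_ext)
    fix i
    have F: "F $ i = T i + w * T (i + 2)" using T[of i] by simp
    consider "i = 0" | "i = 1" | j where "i = j + 2"
      by (metis One_nat_def Suc_1 add.commute add_Suc_right not0_implies_Suc plus_1_eq_Suc)
    then show "F $ i = ((fps_X ^ 2 + fps_const w) * Abs_fps (\<lambda>i. T (i + 2))
        + (fps_const (T 0) + fps_const (T 1) * fps_X)) $ i"
      using F by cases (simp_all add: distrib_right fps_X_power_mult_nth add.commute)
  qed
  then show thesis by (rule that)
qed

text \<open>The coefficients of \<open>G\<close> satisfy $G_i = -w G_{i+2}$, so each is divisible by every power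
  of \<open>w\<close> and vanishes.\<close>

lemma weierstrass_remainder_unique:
  fixes G :: "'k::field fps fps"
  assumes w: "w $ 0 = 0"
    and eq: "(fps_X ^ 2 + fps_const w) * G = fps_const a + fps_const b * fps_X"
  shows "a = 0 \<and> b = 0"
proof -
  have coeff: "((fps_X ^ 2 + fps_const w) * G) $ i = (if i < 2 then 0 else G $ (i - 2)) + w * G $ i" for i
    by (simp add: distrib_right fps_X_power_mult_nth)
  have step: "G $ i = - w * G $ (i + 2)" for i
    using coeff[of "i + 2"] by (simp add: eq eq_neg_iff_add_eq_0)
  have power: "G $ i = (- w) ^ k * G $ (i + 2 * k)" for i k
  proof (induction k)
    case (Suc k)
    then show ?case using step[of "i + 2 * k"] by (simp add: mult_ac)
  qed simp
  have "G = 0"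
  proof (rule fps_ext)
    fix i
    have "G $ i = 0"
    proof (rule ccontr)
      assume nz: "G $ i \<noteq> 0"
      define k where "k = Suc (subdegree (G $ i))"
      have "fps_X dvd w"
        using w fps_X_power_dvd_iff[of 1 w] subdegree_eq_0_iff[of w] by (cases "w = 0") auto
      then have "fps_X ^ k dvd (- w) ^ k" by (intro dvd_power_same) simp
      then have "fps_X ^ k dvd G $ i" by (subst power[of i k]) (rule dvd_mult2)
      then show False using nz by (simp only: fps_X_power_dvd_iff) (simp add: k_def)
    qed
    then show "G $ i = 0 $ i" by simp
  qed
  then have "fps_const a + fps_const b * fps_X = 0" using eq by simp
  then have "(fps_const a + fps_const b * fps_X) $ 0 = 0" "(fps_const a + fps_const b * fps_X) $ 1 = 0"
    by simp_all
  then show ?thesis by simp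
qed


section \<open>Coordinates on $k[[x,y]]/(y^2+x^n)$\<close>

lemma ps_ring_simps [simp]:
  "carrier ps_ring = UNIV" "u \<otimes>\<^bsub>ps_ring\<^esub> v = u * v" "u \<oplus>\<^bsub>ps_ring\<^esub> v = u + v"
  "\<one>\<^bsub>ps_ring\<^esub> = 1" "\<zero>\<^bsub>ps_ring\<^esub> = 0"
  by (simp_all add: ps_ring_def ring_of_type_algebra_def)

lemma cring_ps_ring: "cring ps_ring"
  unfolding ps_ring_def by (rule cring_from_type_algebra)

definition curve_elt :: "nat \<Rightarrow> 'k::field fps \<Rightarrow> 'k fps \<Rightarrow> 'k fps fps set" where
  "curve_elt n a b = curve_ideal n +>\<^bsub>ps_ring\<^esub> (fps_const a + fps_const b * fps_X)"

lemma ideal_curve_ideal: "ideal (curve_ideal n) ps_ring"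
  unfolding curve_ideal_def by (rule ring.genideal_ideal[OF cring.axioms(1)[OF cring_ps_ring]]) simp

lemma curve_ideal_iff:
  "u \<in> curve_ideal n \<longleftrightarrow> fps_X ^ 2 + fps_const (fps_X ^ n) dvd u"
proof -
  have "curve_ideal n = PIdl\<^bsub>ps_ring\<^esub> (ps_y ^ 2 + ps_x ^ n)"
    unfolding curve_ideal_def by (rule cring.cgenideal_eq_genideal[OF cring_ps_ring, symmetric]) simp
  then show ?thesis
    by (auto simp: cgenideal_def ps_x_def ps_y_def fps_const_power dvd_def mult.commute)
qed

lemma curve_coset_eq_iff:
  "curve_ideal n +>\<^bsub>ps_ring\<^esub> u = curve_ideal n +>\<^bsub>ps_ring\<^esub> v \<longleftrightarrow>
     fps_X ^ 2 + fps_const (fps_X ^ n) dvd u - v"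
  for u v :: "'k::field fps fps"
proof -
  interpret I: ideal "curve_ideal n :: 'k fps fps set" ps_ring by (rule ideal_curve_ideal)
  have mem: "u \<in> curve_ideal n +>\<^bsub>ps_ring\<^esub> v \<longleftrightarrow> u - v \<in> curve_ideal n" for u v :: "'k fps fps"
    by (force simp: a_r_coset_def r_coset_def)
  have "curve_ideal n +>\<^bsub>ps_ring\<^esub> u = curve_ideal n +>\<^bsub>ps_ring\<^esub> v \<longleftrightarrow> u \<in> curve_ideal n +>\<^bsub>ps_ring\<^esub> v"
    using I.a_rcos_self[of u] I.a_repr_independence'[of u v] by auto
  then show ?thesis by (simp add: mem curve_ideal_iff)
qed

text \<open>Weierstrass division: every class has exactly one representative $a + b y$.\<close>

lemma curve_coords_curve_ring:
  fixes R :: "'k::field fps fps set ring"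
  assumes "odd n" "R = curve_ring n"
  shows "curve_coords R (curve_elt n) n"
proof -
  let ?I = "curve_ideal n :: 'k fps fps set"
  let ?q = "fps_X ^ 2 + fps_const (fps_X ^ n) :: 'k fps fps"
  interpret I: ideal ?I ps_ring by (rule ideal_curve_ideal)
  have R: "R = ps_ring Quot ?I" using assms(2) by (simp add: curve_ring_def)
  interpret R: cring R
    unfolding R by (rule I.quotient_is_cring[OF cring_ps_ring])
  have w: "(fps_X ^ n :: 'k fps) $ 0 = 0" using odd_pos[OF assms(1)] by simp
  have coset_add: "(?I +>\<^bsub>ps_ring\<^esub> u) \<oplus>\<^bsub>R\<^esub> (?I +>\<^bsub>ps_ring\<^esub> v) = ?I +>\<^bsub>ps_ring\<^esub> (u + v)"
    and coset_mult: "(?I +>\<^bsub>ps_ring\<^esub> u) \<otimes>\<^bsub>R\<^esub> (?I +>\<^bsub>ps_ring\<^esub> v) = ?I +>\<^bsub>ps_ring\<^esub> (u * v)" for u v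
    using I.a_rcos_sum[of u v] I.rcoset_mult_add[of u v] by (simp_all add: R FactRing_def)
  have carr: "carrier R = range (\<lambda>u. ?I +>\<^bsub>ps_ring\<^esub> u)"
    by (auto simp: R FactRing_def A_RCOSETS_def RCOSETS_def a_r_coset_def)
  show ?thesis
  proof unfold_locales
    fix a b c d :: "'k fps"
    show "curve_elt n a b \<in> carrier R" by (simp add: carr curve_elt_def)
    have "curve_elt n a b = curve_elt n c d \<longleftrightarrow> ?q dvd fps_const (a - c) + fps_const (b - d) * fps_X"
      by (simp add: curve_elt_def curve_coset_eq_iff algebra_simps flip: fps_const_sub)
    also have "\<dots> \<longleftrightarrow> a = c \<and> b = d"
    proof
      assume "?q dvd fps_const (a - c) + fps_const (b - d) * fps_X"
      then obtain G where "fps_const (a - c) + fps_const (b - d) * fps_X = ?q * G" by (elim dvdE)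
      then show "a = c \<and> b = d" using weierstrass_remainder_unique[OF w, of G "a - c" "b - d"] by simp
    qed simp
    finally show "curve_elt n a b = curve_elt n c d \<longleftrightarrow> a = c \<and> b = d" .
    show "curve_elt n a b \<oplus>\<^bsub>R\<^esub> curve_elt n c d = curve_elt n (a + c) (b + d)"
      by (simp add: curve_elt_def coset_add algebra_simps flip: fps_const_add)
    have "(fps_const a + fps_const b * fps_X) * (fps_const c + fps_const d * fps_X)
        - (fps_const (a * c - fps_X ^ n * (b * d)) + fps_const (a * d + b * c) * fps_X)
        = ?q * fps_const (b * d)"
      by (simp add: algebra_simps power2_eq_square flip: fps_const_add fps_const_sub fps_const_mult)
    then show "curve_elt n a b \<otimes>\<^bsub>R\<^esub> curve_elt n c d
        = curve_elt n (a * c - fps_X ^ n * (b * d)) (a * d + b * c)"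
      unfolding curve_elt_def coset_mult curve_coset_eq_iff by (rule dvdI)
  next
    fix r assume "r \<in> carrier R"
    then obtain F where F: "r = ?I +>\<^bsub>ps_ring\<^esub> F" by (auto simp: carr)
    obtain G a b where "F = ?q * G + (fps_const a + fps_const b * fps_X)"
      using weierstrass_division_exists[OF w] .
    then have "r = curve_elt n a b" unfolding F curve_elt_def curve_coset_eq_iff by simp
    then show "\<exists>a b. r = curve_elt n a b" by blast
  next
    show "\<zero>\<^bsub>R\<^esub> = curve_elt n 0 0"
      using I.a_rcos_const[OF additive_subgroup.zero_closed[OF I.is_additive_subgroup]] by (simp add: R FactRing_def curve_elt_def)
    show "\<one>\<^bsub>R\<^esub> = curve_elt n 1 0" by (simp add: R FactRing_def curve_elt_def)
  qed (rule assms(1))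
qed


section \<open>The test ideals of the curve\<close>

theorem proposition5p4:
  fixes n :: nat
    and R :: "'k::alg_closed_field fps fps set ring"
    and x y :: "'k fps fps set"
    and \<iota> :: "'k fps fps \<Rightarrow> 'u"
  assumes "odd n"
    and "R = curve_ring n" and "x = curve_x n" and "y = curve_y n"
    and universe_large: "inj \<iota>"
  shows "(\<forall>j\<in>{1..(n - 1) div 2}.
            test_ideal TYPE('u) R (ideal_as_module R (Idl\<^bsub>R\<^esub> {x [^]\<^bsub>R\<^esub> j, y}))
              = Idl\<^bsub>R\<^esub> {x [^]\<^bsub>R\<^esub> j, y})
       \<and> tau_MCM TYPE('u) R = Idl\<^bsub>R\<^esub> {x [^]\<^bsub>R\<^esub> ((n - 1) div 2), y}"
proof -
  interpret curve_coords R "curve_elt n" n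
    by (rule curve_coords_curve_ring[OF assms(1,2)])
  have xy: "x = curve_elt n fps_X 0" "y = curve_elt n 0 1"
    by (simp_all add: assms(3,4) curve_x_def curve_y_def curve_elt_def ps_x_def ps_y_def)
  have Idl: "Idl\<^bsub>R\<^esub> {x [^]\<^bsub>R\<^esub> j, y} = branch_ideal j" if "j \<le> n" for j
    unfolding xy e_power by (rule branch_ideal_eq_genideal[OF that])
  \<comment> \<open>A coset is sent to the image of a chosen representative, so \<open>\<iota>\<close> on power series suffices.\<close>
  define \<kappa> where "\<kappa> r = \<iota> (SOME u. r = curve_ideal n +>\<^bsub>ps_ring\<^esub> u)" for r
  have \<kappa>: "inj_on \<kappa> (carrier R)"
  proof (rule inj_onI)
    have rep: "r = curve_ideal n +>\<^bsub>ps_ring\<^esub> (SOME u. r = curve_ideal n +>\<^bsub>ps_ring\<^esub> u)"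
      if r: "r \<in> carrier R" for r
      by (rule someI_ex) (use e_surj[OF r] in \<open>auto simp: curve_elt_def\<close>)
    fix r s assume rs: "r \<in> carrier R" "s \<in> carrier R" "\<kappa> r = \<kappa> s"
    then have "(SOME u. r = curve_ideal n +>\<^bsub>ps_ring\<^esub> u) = (SOME u. s = curve_ideal n +>\<^bsub>ps_ring\<^esub> u)"
      using injD[OF universe_large] by (simp add: \<kappa>_def)
    then show "r = s" using rep[OF rs(1)] rep[OF rs(2)] by simp
  qed
  obtain m where m: "n = 2 * m + 1" using assms(1) by (rule oddE)
  show ?thesis
    using test_ideal_branch_ideal[OF \<kappa>] tau_MCM_eq_branch_ideal[OF \<kappa> m] by (auto simp: Idl m)
qed

end
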